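(* Let $r>0$ and let $h(\bm{x},\bm{\xi})=\max_{1\le k\le K}\{\bm{a}_k(\bm{x})^T\bm{\xi}+b_k(\bm{x})\}$ with $\bm{a}_k(\bm{x})\in\mathbb{R}^p$ and $b_k(\bm{x})\in\mathbb{R}$ linear in $\bm{x}$ for all $k$. Let the core sets and the sample space be $Y_i=\{\bm{\xi}_i+\bm{A}_i\bm{\zeta}\mid\bm{\zeta}\in Z_{1i}\}$, $i=1,\dots,m$, and $\Xi=\{\bm{\xi}_0+\bm{A}\bm{\zeta}\mid\bm{\zeta}\in Z_2\}$, and let $$\mathcal{D}_W=\{P\in\mathcal{M}(\Xi)\mid W(P,\hat P_N)\le r\}.$$ Then the problem $$\min_{\bm{x}\in X}\ \max_{P\in\mathcal{D}_W}\ E_P\Big[h(\bm{x},\bm{\xi})-\min_{1\le i\le m}\theta_i\min_{\bm{\xi}'\in Y_i}\phi_i(\bm{\xi},\bm{\xi}')\Big]$$ can be equivalently reformulated as $$\min_{\bm{x},\lambda,s_j,\bm{v}_{ijk},\bm{w}_{ijk}}\ \ \lambda r+\frac1N\sum_{j=1}^N s_j$$ subject to, for all $1\le j\le N$, $1\le i\le m$, $1\le k\le K$, $$\bm{\xi}_i^T\bm{v}_{ijk}+\delta^*(\bm{A}_i^T\bm{v}_{ijk}|Z_{1i})+\bm{\xi}_0^T\bm{w}_{ijk}+\delta^*(\bm{A}^T\bm{w}_{ijk}|Z_2)-\hat{\bm{\xi}}_j^T(\bm{v}_{ijk}+\bm{w}_{ijk}-\bm{a}_k(\bm{x}))+b_k(\bm{x})-s_j+\theta_i\phi_i^{**}\big(\tfrac{\bm{v}_{ijk}}{\theta_i},-\tfrac{\bm{v}_{ijk}}{\theta_i}\big)\le0,$$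 $$\|\bm{v}_{ijk}+\bm{w}_{ijk}-\bm{a}_k(\bm{x})\|_*\le\lambda,$$ and $\lambda\ge0$, $\bm{x}\in X$, where $s_j\in\mathbb{R}$ and $\bm{v}_{ijk},\bm{w}_{ijk}\in\mathbb{R}^p$. That is, for each $\bm{x}\in X$ the inner maximum over $P\in\mathcal{D}_W$ equals the minimum of the second problem over its remaining variables with $\bm{x}$ fixed, so the two problems have the same optimal value and the same optimal decisions $\bm{x}$.
   Context: Notation and standing assumptions. $X\subseteq\mathbb{R}^n$ is a closed convex set. $\|\cdot\|$ is a norm on $\mathbb{R}^p$ and $\|\cdot\|_*$ is its dual norm. $\mathcal{M}(\Xi)$ is the set of probability measures $P$ on $(\Xi,\mathcal{B}(\Xi))$ with $E_P[\|\bm{\xi}\|]<\infty$, where $\mathcal{B}(\Xi)$ is the Borel $\sigma$-algebra of $\Xi\subseteq\mathbb{R}^p$, $\bm{\xi}$ is the identity random vector on $\Xi$, and $E_P$ denotes expectation under $P$. $\hat{\bm{\xi}}_1,\dots,\hat{\bm{\xi}}_N\in\Xi$ are given samples and $\hat P_N=\frac1N\sum_{j=1}^N\delta_{\hat{\bm{\xi}}_j}$ is the empirical distribution, with $\delta_{\hat{\bm{\xi}}_j}$ the Dirac point mass at $\hat{\bm{\xi}}_j$. $W$ is the type-1 Wasserstein distance $$W(P,Q)=\inf\Big\{\int_{\Xi^2}\|\bm{\xi}-\bm{\eta}\|\,\Pi(d\bm{\xi},d\bm{\eta})\ \Big|\ \Pi\text{ is a joint distribution of }\bm{\xi}\text{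 and }\bm{\eta}\text{ with marginals }P\text{ and }Q\Big\}.$$ Sets: $\bm{\xi}_0,\bm{\xi}_1,\dots,\bm{\xi}_m\in\mathbb{R}^p$ and $\bm{A},\bm{A}_1,\dots,\bm{A}_m\in\mathbb{R}^{p\times L}$ are given; each $Z_{1i}\subseteq\mathbb{R}^L$ is nonempty, convex and compact with $0$ in its relative interior; $Z_2\subseteq\mathbb{R}^L$ is convex; and these data satisfy $Y_i\subseteq\Xi$ for all $i$. Penalties: $\theta_i>0$, and each $\phi_i:\mathbb{R}^p\times\mathbb{R}^p\to\mathbb{R}$ is closed, jointly convex and nonnegative, with $\phi_i(\bm{\xi},\bm{\xi})=0$ for all $\bm{\xi}\in\mathbb{R}^p$. Conjugates: $\phi_i^{**}(\bm{u},\bm{u}')=\sup_{\bm{\xi},\bm{\xi}'\in\mathbb{R}^p}\{\bm{u}^T\bm{\xi}+\bm{u}'^T\bm{\xi}'-\phi_i(\bm{\xi},\bm{\xi}')\}$ is the convex conjugate of $\phi_i$ with respect to both variables jointly (not the biconjugate), and $\delta^*(\bm{u}|S)=\sup_{\bm{\zeta}\in S}\bm{u}^T\bm{\zeta}$ is the support function of $S$ (the conjugate of its indicator function). Both may take the value $+\infty$; a constraint in which such a term equals $+\infty$ is regarded as violated. The outer "min" and inner "max" in the optimization problems denote infimum and supremum; an expectation under $P\in\mathcal{M}(\Xi)$ may equal $-\infty$ (the positive part of the integrand is always integrable). *)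

theory Defs
  imports "HOL-Probability.Probability"
begin

text \<open>
  The norm on \<open>\<real>\<^sup>p\<close> is an arbitrary one, hence a function \<open>nrm\<close> and not the class operation
  \<^const>\<open>norm\<close>, which is Euclidean on \<^typ>\<open>real ^ 'p\<close>.
\<close>

definition is_norm :: "('v::real_vector \<Rightarrow> real) \<Rightarrow> bool" where
  "is_norm nrm \<longleftrightarrow>
     (\<forall>x. nrm x = 0 \<longleftrightarrow> x = 0) \<and>
     (\<forall>c x. nrm (c *\<^sub>R x) = \<bar>c\<bar> * nrm x) \<and>
     (\<forall>x y. nrm (x + y) \<le> nrm x + nrm y)"

definition dual_norm :: "('v::real_inner \<Rightarrow> real) \<Rightarrow> 'v \<Rightarrow> real" where
  "dual_norm nrm u = (SUP x\<in>{x. nrm x \<le> 1}. u \<bullet> x)"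

definition support_function :: "'v::real_inner set \<Rightarrow> 'v \<Rightarrow> ereal" where
  "support_function S u = (SUP \<zeta>\<in>S. ereal (u \<bullet> \<zeta>))"

definition joint_conjugate :: "('v::real_inner \<Rightarrow> 'v \<Rightarrow> real) \<Rightarrow> 'v \<Rightarrow> 'v \<Rightarrow> ereal" where
  "joint_conjugate \<phi> u u' = (SUP (\<xi>, \<xi>')\<in>UNIV. ereal (u \<bullet> \<xi> + u' \<bullet> \<xi>' - \<phi> \<xi> \<xi>'))"

text \<open>
  The trace \<open>\<sigma>\<close>-algebra is used since \<open>\<Xi>\<close> need not be a Borel subset of the whole space.
\<close>

abbreviation borel_on :: "'v::topological_space set \<Rightarrow> 'v measure" where
  "borel_on \<Xi> \<equiv> restrict_space borel \<Xi>"

definition prob_measures :: "('v::euclidean_space \<Rightarrow> real) \<Rightarrow> 'v set \<Rightarrow> 'v measure set" where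
  "prob_measures nrm \<Xi> = {P. prob_space P \<and> sets P = sets (borel_on \<Xi>) \<and> integrable P nrm}"

definition empirical_measure :: "'v::euclidean_space set \<Rightarrow> nat \<Rightarrow> (nat \<Rightarrow> 'v) \<Rightarrow> 'v measure" where
  "empirical_measure \<Xi> N \<xi>h =
     measure_of \<Xi> (sets (borel_on \<Xi>))
       (\<lambda>B. ennreal (1 / real N) * (\<Sum>j=1..N. emeasure (return (borel_on \<Xi>) (\<xi>h j)) B))"

definition couplings :: "'v measure \<Rightarrow> 'v measure \<Rightarrow> ('v \<times> 'v) measure set" where
  "couplings P Q =
     {\<gamma>. prob_space \<gamma> \<and> sets \<gamma> = sets (P \<Otimes>\<^sub>M Q) \<and> distr \<gamma> P fst = P \<and> distr \<gamma> Q snd = Q}"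

definition wasserstein :: "('v::euclidean_space \<Rightarrow> real) \<Rightarrow> 'v measure \<Rightarrow> 'v measure \<Rightarrow> ennreal" where
  "wasserstein nrm P Q =
     (INF \<gamma>\<in>couplings P Q. \<integral>\<^sup>+ (\<xi>, \<eta>). ennreal (nrm (\<xi> - \<eta>)) \<partial>\<gamma>)"

definition wasserstein_ball ::
  "('v::euclidean_space \<Rightarrow> real) \<Rightarrow> 'v set \<Rightarrow> nat \<Rightarrow> (nat \<Rightarrow> 'v) \<Rightarrow> real \<Rightarrow> 'v measure set" where
  "wasserstein_ball nrm \<Xi> N \<xi>h r =
     {P \<in> prob_measures nrm \<Xi>. wasserstein nrm P (empirical_measure \<Xi> N \<xi>h) \<le> ennreal r}"

text \<open>
  Expectation with values in the extended reals, meaningful when the positive part of \<open>f\<close> is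
  integrable (it is then real or \<open>-\<infinity>\<close>); the Bochner integral would return \<open>0\<close> for a
  non-integrable \<open>f\<close>.
\<close>

definition ext_expectation :: "'v measure \<Rightarrow> ('v \<Rightarrow> real) \<Rightarrow> ereal" where
  "ext_expectation P f =
     enn2ereal (\<integral>\<^sup>+ \<xi>. ennreal (f \<xi>) \<partial>P) - enn2ereal (\<integral>\<^sup>+ \<xi>. ennreal (- f \<xi>) \<partial>P)"

end

(*
  Weak duality: a feasible point of the second problem bounds the integrand by
  s_j + lam * nrm (z - xh_j) for all j and all z in Xi.  The minimum over j of the shifted functions
  s_j + lam * nrm (y - xh_j) turns this into a bound by a function of y plus lam * nrm (z - y), which
  integrates against any coupling of P with the empirical measure.

  Strong duality for the measures: the pairs (transport cost, expected value) of finitely supported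
  couplings form a convex set, and separating it from {c <= r} x {v > worst case} yields lam; the
  hyperplane is not vertical because r > 0 and the trivial coupling has cost 0.

  Strong duality for the constraints: each of them is a Fenchel dual certificate.  Since phi_i and the
  norm are finite everywhere, no constraint qualification is needed and the dual optimum is
  attained.  Because phi_i vanishes on the diagonal, its conjugate is finite only at points
  (v, -v), which is why a single v suffices.
*)

theory Submission
  imports Defs
begin

section \<open>Norms and Fenchel separation\<close>

lemma is_norm_zero: "is_norm nrm \<Longrightarrow> nrm 0 = 0"
  by (simp add: is_norm_def)

lemma is_norm_scale: "is_norm nrm \<Longrightarrow> nrm (c *\<^sub>R x) = \<bar>c\<bar> * nrm x"
  by (simp add: is_norm_def)

lemma is_norm_triangle: "is_norm nrm \<Longrightarrow> nrm (x + y) \<le> nrm x + nrm y"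
  by (simp add: is_norm_def)

lemma is_norm_minus:
  assumes "is_norm nrm" shows "nrm (- x) = nrm x"
  using is_norm_scale[OF assms, of "-1" x] by simp

lemma is_norm_nonneg:
  assumes "is_norm nrm" shows "0 \<le> nrm x"
  using is_norm_triangle[OF assms, of x "-x"]
  by (simp add: is_norm_zero[OF assms] is_norm_minus[OF assms])

lemma is_norm_diff_commute:
  assumes "is_norm nrm" shows "nrm (x - y) = nrm (y - x)"
  using is_norm_minus[OF assms, of "x - y"] by simp

lemma is_norm_diff_triangle:
  assumes "is_norm nrm" shows "nrm (x - z) \<le> nrm (x - y) + nrm (y - z)"
  using is_norm_triangle[OF assms, of "x - y" "y - z"] by simp

lemma convex_on_is_norm_diff:
  assumes "is_norm nrm" shows "convex_on UNIV (\<lambda>x. nrm (x - c))"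
proof (rule convex_onI)
  fix t :: real and x y
  assume t: "0 < t" "t < 1"
  have "(1 - t) *\<^sub>R x + t *\<^sub>R y - c = (1 - t) *\<^sub>R (x - c) + t *\<^sub>R (y - c)"
    by (simp add: algebra_simps)
  then show "nrm ((1 - t) *\<^sub>R x + t *\<^sub>R y - c) \<le> (1 - t) * nrm (x - c) + t * nrm (y - c)"
    using is_norm_triangle[OF assms, of "(1 - t) *\<^sub>R (x - c)" "t *\<^sub>R (y - c)"] t
    by (simp add: is_norm_scale[OF assms])
qed auto

text \<open>A finite convex function on an open subset of a Euclidean space is continuous.\<close>

lemma continuous_on_is_norm:
  fixes nrm :: "'v::euclidean_space \<Rightarrow> real"
  assumes "is_norm nrm" shows "continuous_on UNIV nrm"
  using convex_on_continuous[OF open_UNIV convex_on_is_norm_diff[OF assms, of 0]] by simp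

text \<open>By compactness \<open>nrm\<close> attains its minimum over the Euclidean unit sphere;
  the minimum is positive, and homogeneity turns its reciprocal into \<open>B\<close>.\<close>

lemma norm_le_is_norm:
  fixes nrm :: "'v::euclidean_space \<Rightarrow> real"
  assumes "is_norm nrm"
  obtains B where "B > 0" "\<And>x. norm x \<le> B * nrm x"
proof -
  have "compact (sphere (0::'v) 1)" "sphere (0::'v) 1 \<noteq> {}" by auto
  then obtain x0 where x0: "x0 \<in> sphere 0 1" "\<And>y. y \<in> sphere 0 1 \<Longrightarrow> nrm x0 \<le> nrm y"
    using continuous_attains_inf[of "sphere 0 1" nrm]
      continuous_on_subset[OF continuous_on_is_norm[OF assms]] by blast
  have pos: "nrm x0 > 0"
    using x0(1) is_norm_nonneg[OF assms, of x0] assms unfolding is_norm_def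
    by (metis less_eq_real_def norm_zero mem_sphere_0 zero_neq_one)
  have "norm x \<le> 1 / nrm x0 * nrm x" for x
  proof (cases "x = 0")
    case False
    then have "nrm x0 \<le> nrm ((1 / norm x) *\<^sub>R x)" by (intro x0(2)) simp
    with False pos show ?thesis by (simp add: is_norm_scale[OF assms] field_simps)
  qed (use is_norm_nonneg[OF assms] pos in simp)
  with pos show thesis by (intro that[of "1 / nrm x0"]) auto
qed

section \<open>Pairing of a norm with its dual norm\<close>

lemma inner_le_dual_norm:
  fixes nrm :: "'v::euclidean_space \<Rightarrow> real"
  assumes "is_norm nrm"
  shows "u \<bullet> x \<le> dual_norm nrm u * nrm x"
proof (cases "x = 0")
  case False
  then have pos: "nrm x > 0"
    using is_norm_nonneg[OF assms, of x] assms unfolding is_norm_def by (metis less_eq_real_def)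
  obtain B where B: "B > 0" "\<And>x. norm x \<le> B * nrm x" using norm_le_is_norm[OF assms] by blast
  \<comment> \<open>The dual norm is a real supremum, so boundedness has to be shown: the unit ball
    of \<open>nrm\<close> lies in the Euclidean ball of radius \<open>B\<close>.\<close>
  have "bdd_above ((\<lambda>x. u \<bullet> x) ` {x. nrm x \<le> 1})"
  proof (rule bdd_aboveI2)
    fix x assume "x \<in> {x. nrm x \<le> 1}"
    then have "B * nrm x \<le> B * 1" using B(1) by (intro mult_left_mono) auto
    then have "norm x \<le> B" using B(2)[of x] by linarith
    then show "u \<bullet> x \<le> norm u * B"
      using norm_cauchy_schwarz[of u x] mult_left_mono[of "norm x" B "norm u"] by (meson norm_ge_zero order_trans)
  qed
  then have "u \<bullet> ((1 / nrm x) *\<^sub>R x) \<le> dual_norm nrm u"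
    unfolding dual_norm_def using pos
    by (intro cSUP_upper) (auto simp: is_norm_scale[OF assms])
  with pos show ?thesis by (simp add: field_simps)
qed (simp add: is_norm_zero[OF assms])

lemma dual_norm_nonneg:
  fixes nrm :: "'v::euclidean_space \<Rightarrow> real"
  assumes "is_norm nrm"
  shows "0 \<le> dual_norm nrm u"
proof (cases "u = 0")
  case False
  then have "nrm u > 0"
    using is_norm_nonneg[OF assms, of u] assms unfolding is_norm_def by (metis less_eq_real_def)
  moreover have "0 \<le> dual_norm nrm u * nrm u"
    using inner_le_dual_norm[OF assms, of u u] inner_ge_zero[of u] by linarith
  ultimately show ?thesis by (simp add: zero_le_mult_iff)
next
  case True
  have "{x. nrm x \<le> 1} \<noteq> {}"
    using is_norm_zero[OF assms] by (metis (mono_tags) empty_iff mem_Collect_eq zero_le_one)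
  with True show ?thesis by (simp add: dual_norm_def)
qed

lemma dual_norm_le:
  fixes nrm :: "'v::euclidean_space \<Rightarrow> real"
  assumes "is_norm nrm" "0 \<le> c" "\<And>x. u \<bullet> x \<le> c * nrm x"
  shows "dual_norm nrm u \<le> c"
  unfolding dual_norm_def
proof (rule cSUP_least)
  show "{x. nrm x \<le> 1} \<noteq> {}"
    using is_norm_zero[OF assms(1)] by (metis (mono_tags) empty_iff mem_Collect_eq zero_le_one)
  fix x assume "x \<in> {x. nrm x \<le> 1}"
  then show "u \<bullet> x \<le> c" using assms(3)[of x] mult_left_mono[of "nrm x" 1 c] assms(2) by simp
qed

text \<open>A hyperplane separates the strict epigraph of \<open>F\<close> from the hypograph of
  \<open>- G\<close> over \<open>C\<close>; since \<open>F\<close> is finite everywhere it is not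
  vertical, and \<open>q\<close> is its slope. Read with a supremum over \<open>x\<close> and an
  infimum over \<open>y\<close>, the conclusion says that the Fenchel dual of a nonnegative
  \<open>F + G\<close> takes a nonnegative value at \<open>q\<close>.\<close>

lemma fenchel_separation:
  fixes F :: "'v::euclidean_space \<Rightarrow> real"
  assumes F: "convex_on UNIV F" and G: "convex_on C G" and ne: "C \<noteq> {}"
    and nonneg: "\<And>x. x \<in> C \<Longrightarrow> 0 \<le> F x + G x"
  obtains q where "\<And>x y. y \<in> C \<Longrightarrow> q \<bullet> x - F x \<le> q \<bullet> y + G y"
proof -
  define S where "S = {(x, t). F x < t}"
  define T where "T = {(y, t). y \<in> C \<and> t \<le> - G y}"
  have "convex S"
  proof (rule convexI)
    fix p q :: "'v \<times> real" and u v :: real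
    assume *: "p \<in> S" "q \<in> S" "0 \<le> u" "0 \<le> v" "u + v = 1"
    obtain x s y t where pq: "p = (x, s)" "q = (y, t)" by fastforce
    have "F (u *\<^sub>R x + v *\<^sub>R y) \<le> u * F x + v * F y"
      using F * unfolding convex_on_def by blast
    also have "\<dots> < u * s + v * t"
    proof (cases "u = 0")
      case False
      with * pq have "u * F x < u * s" "v * F y \<le> v * t"
        by (auto simp: S_def intro: mult_left_mono)
      then show ?thesis by linarith
    qed (use * pq in \<open>auto simp: S_def\<close>)
    finally show "u *\<^sub>R p + v *\<^sub>R q \<in> S" by (simp add: pq S_def)
  qed
  moreover have "convex T"
  proof (rule convexI)
    fix p q :: "'v \<times> real" and u v :: real
    assume *: "p \<in> T" "q \<in> T" "0 \<le> u" "0 \<le> v" "u + v = 1"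
    obtain x s y t where pq: "p = (x, s)" "q = (y, t)" by fastforce
    have xy: "x \<in> C" "y \<in> C" "s \<le> - G x" "t \<le> - G y" using * pq by (auto simp: T_def)
    have "u * s + v * t \<le> u * (- G x) + v * (- G y)"
      by (intro add_mono mult_left_mono xy *)
    also have "\<dots> \<le> - G (u *\<^sub>R x + v *\<^sub>R y)"
      using G * xy unfolding convex_on_def by fastforce
    finally show "u *\<^sub>R p + v *\<^sub>R q \<in> T"
      using G * xy by (simp add: pq T_def convex_on_def convexD)
  qed
  moreover have "S \<inter> T = {}" using nonneg by (force simp: S_def T_def)
  moreover have "(undefined, F undefined + 1) \<in> S" by (simp add: S_def)
  moreover obtain c where c: "c \<in> C" using ne by blast
  then have "(c, - G c) \<in> T" by (simp add: T_def)
  ultimately obtain a b where ab: "a \<noteq> 0" "\<forall>x\<in>S. a \<bullet> x \<le> b" "\<forall>x\<in>T. b \<le> a \<bullet> x"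
    using separating_hyperplane_sets[of S T] by blast
  obtain p \<alpha> where a: "a = (p, \<alpha>)" by fastforce
  have 1: "p \<bullet> x + \<alpha> * t \<le> b" if "F x < t" for x t
    using ab(2) that by (auto simp: S_def a)
  have 2: "b \<le> p \<bullet> y + \<alpha> * t" if "y \<in> C" "t \<le> - G y" for y t
    using ab(3) that by (auto simp: T_def a)
  have "\<alpha> \<le> 0"
  proof (rule ccontr)
    assume "\<not> \<alpha> \<le> 0"
    \<comment> \<open>The chosen height lies above \<open>F c\<close> and makes the factor of
      \<alpha> below at least 1.\<close>
    have "p \<bullet> c + \<alpha> * (\<bar>F c\<bar> + 1 + \<bar>G c\<bar>) \<le> p \<bullet> c + \<alpha> * (- G c)"
      using 1[of c "\<bar>F c\<bar> + 1 + \<bar>G c\<bar>"] 2[OF c, of "- G c"] by linarith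
    then have "\<alpha> * (\<bar>F c\<bar> + 1 + \<bar>G c\<bar> + G c) \<le> 0" by (simp add: algebra_simps)
    then show False using \<open>\<not> \<alpha> \<le> 0\<close> by (simp add: mult_le_0_iff)
  qed
  moreover have "\<alpha> \<noteq> 0"
  proof
    \<comment> \<open>\<open>S\<close> projects onto the whole space, so a vertical hyperplane would
      keep \<open>p \<bullet> x\<close> below \<open>p \<bullet> c\<close> for every
      \<open>x\<close>; \<open>x = c + p\<close> forces \<open>p = 0\<close>, against
      \<open>a \<noteq> 0\<close>.\<close>
    assume 0: "\<alpha> = 0"
    then have "p \<bullet> (c + p) \<le> p \<bullet> c"
      using 1[of "c + p" "F (c + p) + 1"] 2[OF c, of "- G c"] by simp
    then have "p \<bullet> p \<le> 0" by (simp add: inner_right_distrib)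
    then have "p = 0" by (metis inner_gt_zero_iff not_le)
    then show False using 0 ab(1) a by (simp add: zero_prod_def)
  qed
  ultimately have neg: "\<alpha> < 0" by simp
  have 3: "p \<bullet> x + \<alpha> * F x \<le> p \<bullet> y + \<alpha> * (- G y)" if "y \<in> C" for x y
  proof -
    \<comment> \<open>Points of \<open>S\<close> lie strictly above the graph of \<open>F\<close>;
      letting \<open>t\<close> decrease to \<open>F x\<close> carries the bound over to the
      graph.\<close>
    have "F x \<ge> (b - p \<bullet> x) / \<alpha>"
    proof (rule dense_ge)
      fix t assume "F x < t"
      then show "(b - p \<bullet> x) / \<alpha> \<le> t" using 1[of x t] neg by (simp add: field_simps)
    qed
    then have "p \<bullet> x + \<alpha> * F x \<le> b" using neg by (simp add: field_simps)
    then show ?thesis using 2[OF that, of "- G y"] by simp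
  qed
  show thesis
  proof (rule that)
    fix x y assume "y \<in> C"
    \<comment> \<open>Dividing by \<open>- \<alpha>\<close> normalises the last coordinate of the
      normal to -1.\<close>
    from 3[OF this, of x] neg
    have "(- (1 / \<alpha>)) * (p \<bullet> x + \<alpha> * F x) \<le> (- (1 / \<alpha>)) * (p \<bullet> y + \<alpha> * (- G y))"
      by (intro mult_left_mono) auto
    then show "(- (1 / \<alpha>)) *\<^sub>R p \<bullet> x - F x \<le> (- (1 / \<alpha>)) *\<^sub>R p \<bullet> y + G y"
      using neg by (simp add: distrib_left diff_divide_distrib)
  qed
qed

section \<open>The dual constraints\<close>

lemma inner_transpose_matrix:
  fixes A :: "real ^ 'l ^ 'p"
  shows "(transpose A *v w) \<bullet> \<zeta> = w \<bullet> (A *v \<zeta>)"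
  by (simp add: dot_lmul_matrix)

lemma support_function_upper: "\<zeta> \<in> S \<Longrightarrow> ereal (u \<bullet> \<zeta>) \<le> support_function S u"
  unfolding support_function_def by (rule SUP_upper)

lemma joint_conjugate_upper: "ereal (u \<bullet> x + u' \<bullet> x' - \<phi> x x') \<le> joint_conjugate \<phi> u u'"
  unfolding joint_conjugate_def by (rule SUP_upper2[where i = "(x, x')"]) auto

lemma joint_conjugate_least:
  assumes "\<And>x x'. u \<bullet> x + u' \<bullet> x' - \<phi> x x' \<le> c"
  shows "joint_conjugate \<phi> u u' \<le> ereal c"
  unfolding joint_conjugate_def by (rule SUP_least) (use assms in auto)

text \<open>Evaluating the support functions at \<zeta> and \<eta> and the conjugate at
  \<open>(z, z')\<close> only lowers the left-hand side. The \<open>v \<bullet> z'\<close> terms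
  cancel, leaving \<open>a \<bullet> z + b - \<theta> * \<phi> z z' - s\<close> plus
  \<open>(v + w - a) \<bullet> (z - xh)\<close>, and the dual norm bounds the latter below by
  \<open>- lam * nrm (z - xh)\<close>.\<close>

lemma le_of_dual_constraint:
  fixes A1 :: "real ^ 'l ^ 'p" and A :: "real ^ 'k ^ 'p"
  assumes nrm: "is_norm nrm" and \<theta>: "\<theta> > 0"
    and *: "ereal (x1 \<bullet> v) + support_function Z1 (transpose A1 *v v)
        + ereal (x0 \<bullet> w) + support_function Z2 (transpose A *v w)
        + ereal (- (xh \<bullet> (v + w - a)) + b - s)
        + ereal \<theta> * joint_conjugate \<phi> ((1 / \<theta>) *\<^sub>R v) (- ((1 / \<theta>) *\<^sub>R v)) \<le> 0"
    and dual: "dual_norm nrm (v + w - a) \<le> lam"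
    and z: "\<zeta> \<in> Z1" "\<eta> \<in> Z2" "z = x0 + A *v \<eta>" "z' = x1 + A1 *v \<zeta>"
  shows "a \<bullet> z + b - \<theta> * \<phi> z z' \<le> s + lam * nrm (z - xh)"
proof -
  have "ereal \<theta> * ereal ((1 / \<theta>) *\<^sub>R v \<bullet> z + - ((1 / \<theta>) *\<^sub>R v) \<bullet> z' - \<phi> z z')
      \<le> ereal \<theta> * joint_conjugate \<phi> ((1 / \<theta>) *\<^sub>R v) (- ((1 / \<theta>) *\<^sub>R v))"
    using \<theta> by (intro ereal_mult_left_mono joint_conjugate_upper) auto
  then have "ereal (x1 \<bullet> v) + ereal ((transpose A1 *v v) \<bullet> \<zeta>)
        + ereal (x0 \<bullet> w) + ereal ((transpose A *v w) \<bullet> \<eta>)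
        + ereal (- (xh \<bullet> (v + w - a)) + b - s)
        + ereal \<theta> * ereal ((1 / \<theta>) *\<^sub>R v \<bullet> z + - ((1 / \<theta>) *\<^sub>R v) \<bullet> z' - \<phi> z z') \<le> 0"
    by (intro order_trans[OF _ *] add_mono order_refl support_function_upper z)
  then have "x1 \<bullet> v + v \<bullet> (A1 *v \<zeta>) + x0 \<bullet> w + w \<bullet> (A *v \<eta>)
        + (- (xh \<bullet> (v + w - a)) + b - s)
        + \<theta> * ((1 / \<theta>) *\<^sub>R v \<bullet> z + - ((1 / \<theta>) *\<^sub>R v) \<bullet> z' - \<phi> z z') \<le> 0"
    unfolding inner_transpose_matrix by simp
  moreover have "\<theta> * ((1 / \<theta>) *\<^sub>R v \<bullet> z + - ((1 / \<theta>) *\<^sub>R v) \<bullet> z' - \<phi> z z')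
      = v \<bullet> z - v \<bullet> z' - \<theta> * \<phi> z z'"
    using \<theta> by (simp add: field_simps)
  moreover have "x1 \<bullet> v + v \<bullet> (A1 *v \<zeta>) = v \<bullet> z'" "x0 \<bullet> w + w \<bullet> (A *v \<eta>) = w \<bullet> z"
    by (simp_all add: z inner_add_right inner_commute)
  moreover have "- ((v + w - a) \<bullet> (z - xh)) \<le> lam * nrm (z - xh)"
  proof -
    have "(v + w - a) \<bullet> (xh - z) \<le> dual_norm nrm (v + w - a) * nrm (xh - z)"
      by (rule inner_le_dual_norm[OF nrm])
    also have "\<dots> \<le> lam * nrm (xh - z)"
      by (intro mult_right_mono dual is_norm_nonneg nrm)
    finally show ?thesis
      by (simp add: is_norm_diff_commute[OF nrm, of xh] inner_diff_right)
  qed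
  ultimately show ?thesis
    by (simp add: inner_diff_right inner_diff_left inner_add_left inner_add_right inner_commute)
qed

text \<open>The certificate comes from two successive separations. The first, on pairs
  \<open>(z, z')\<close>, linearises the penalty and yields \<open>v\<close>; the second, on
  \<open>z\<close> alone, linearises the norm term and yields \<open>w\<close>.\<close>

lemma ex_dual_constraint:
  fixes A1 :: "real ^ 'l ^ 'p" and A :: "real ^ 'k ^ 'p"
  assumes nrm: "is_norm nrm" and \<theta>: "\<theta> > 0" and lam: "lam \<ge> 0"
    and Z1: "Z1 \<noteq> {}" "convex Z1" "compact Z1" and Z2: "Z2 \<noteq> {}" "convex Z2"
    and \<phi>: "convex_on UNIV (\<lambda>(z, z'). \<phi> z z')" "\<And>z. \<phi> z z = 0"
    and *: "\<And>\<zeta> \<eta> z z'. \<zeta> \<in> Z1 \<Longrightarrow> \<eta> \<in> Z2 \<Longrightarrow> z = x0 + A *v \<eta> \<Longrightarrow> z' = x1 + A1 *v \<zeta> \<Longrightarrow>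
      a \<bullet> z + b - \<theta> * \<phi> z z' \<le> s + lam * nrm (z - xh)"
  shows "\<exists>v w. ereal (x1 \<bullet> v) + support_function Z1 (transpose A1 *v v)
        + ereal (x0 \<bullet> w) + support_function Z2 (transpose A *v w)
        + ereal (- (xh \<bullet> (v + w - a)) + b - s)
        + ereal \<theta> * joint_conjugate \<phi> ((1 / \<theta>) *\<^sub>R v) (- ((1 / \<theta>) *\<^sub>R v)) \<le> 0
      \<and> dual_norm nrm (v + w - a) \<le> lam"
proof -
  define Y where "Y = (\<lambda>\<zeta>. x1 + A1 *v \<zeta>) ` Z1"
  define \<Xi> where "\<Xi> = (\<lambda>\<eta>. x0 + A *v \<eta>) ` Z2"
  have "convex ((+) x1 ` ((*v) A1 ` Z1))" "convex ((+) x0 ` ((*v) A ` Z2))"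
    by (intro convex_translation convex_linear_image matrix_vector_mul_linear Z1 Z2)+
  then have cvx: "convex Y" "convex \<Xi>" by (simp_all add: Y_def \<Xi>_def image_image)
  have ne: "Y \<noteq> {}" "\<Xi> \<noteq> {}" using Z1 Z2 by (auto simp: Y_def \<Xi>_def)
  have ub: "a \<bullet> z + b - \<theta> * \<phi> z z' \<le> s + lam * nrm (z - xh)" if "z \<in> \<Xi>" "z' \<in> Y" for z z'
    using that * unfolding Y_def \<Xi>_def by blast
  have N: "convex_on UNIV (\<lambda>z. lam * nrm (z - xh))"
    by (intro convex_on_cmul lam convex_on_is_norm_diff nrm)

  \<comment> \<open>\<open>g\<close> collects all terms of the assumed bound except the penalty, so
    that the bound reads \<open>0 \<le> \<theta> * \<phi> z z' + g z\<close>.\<close>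
  define g where "g z = lam * nrm (z - xh) + (s - b - a \<bullet> z)" for z
  have "convex_on \<Xi> (\<lambda>z. s - b - a \<bullet> z)"
    using cvx by (intro convex_onI) (auto simp: algebra_simps)
  then have g: "convex_on \<Xi> g"
    unfolding g_def by (intro convex_on_add convex_on_subset[OF N] cvx) auto
  have G1: "convex_on (\<Xi> \<times> Y) (\<lambda>p. g (fst p))"
    using g cvx unfolding convex_on_def by (auto intro: convex_Times)
  have F1: "convex_on UNIV (\<lambda>p. \<theta> * (case p of (z, z') \<Rightarrow> \<phi> z z'))"
    using \<theta> \<phi> by (intro convex_on_cmul) auto
  have "\<Xi> \<times> Y \<noteq> {}" using ne by auto
  moreover have "0 \<le> \<theta> * (case p of (z, z') \<Rightarrow> \<phi> z z') + g (fst p)" if "p \<in> \<Xi> \<times> Y" for p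
    using that ub[of "fst p" "snd p"] by (cases p) (simp add: g_def)
  ultimately obtain q where q: "\<And>p p'. p' \<in> \<Xi> \<times> Y \<Longrightarrow>
      q \<bullet> p - \<theta> * (case p of (z, z') \<Rightarrow> \<phi> z z') \<le> q \<bullet> p' + g (fst p')"
    using fenchel_separation[OF F1 G1] by blast
  obtain v q2 where q_eq: "q = (v, q2)" by fastforce
  have sep: "v \<bullet> x + q2 \<bullet> x' - \<theta> * \<phi> x x' \<le> v \<bullet> z + q2 \<bullet> z' + g z" if "z \<in> \<Xi>" "z' \<in> Y" for x x' z z'
    using q[of "(z, z')" "(x, x')"] that by (simp add: q_eq)
  obtain c c' where c: "c \<in> \<Xi>" "c' \<in> Y" using ne by blast
  \<comment> \<open>\<open>\<phi>\<close> vanishes on the diagonal, so its conjugate is finite only at points of the form \<open>(v, - v)\<close>.\<close>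
  have "v + q2 = 0"
  proof (rule ccontr)
    assume "v + q2 \<noteq> 0"
    define d where "d = (v + q2) \<bullet> (v + q2)"
    define B where "B = v \<bullet> c + q2 \<bullet> c' + g c"
    have "d > 0" using \<open>v + q2 \<noteq> 0\<close> by (simp add: d_def)
    have "t * d \<le> B" for t
      using sep[OF c, of "t *\<^sub>R (v + q2)" "t *\<^sub>R (v + q2)"] \<phi>(2)
      by (simp add: d_def B_def inner_add_left algebra_simps)
    from this[of "(B + 1) / d"] \<open>d > 0\<close> show False by simp
  qed
  then have q2: "q2 = - v" by (simp add: eq_neg_iff_add_eq_0 add.commute)
  define J where "J = joint_conjugate \<phi> ((1 / \<theta>) *\<^sub>R v) (- ((1 / \<theta>) *\<^sub>R v))"
  have J_le: "J \<le> ereal ((v \<bullet> z - v \<bullet> z' + g z) / \<theta>)" if "z \<in> \<Xi>" "z' \<in> Y" for z z'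
    unfolding J_def
  proof (rule joint_conjugate_least)
    fix x x'
    have "(1 / \<theta>) *\<^sub>R v \<bullet> x + - ((1 / \<theta>) *\<^sub>R v) \<bullet> x' - \<phi> x x' = (v \<bullet> x - v \<bullet> x' - \<theta> * \<phi> x x') / \<theta>"
      using \<theta> by (simp add: field_simps)
    also have "\<dots> \<le> (v \<bullet> z - v \<bullet> z' + g z) / \<theta>"
      using sep[OF that, of x x'] \<theta> by (intro divide_right_mono) (simp_all add: q2)
    finally show "(1 / \<theta>) *\<^sub>R v \<bullet> x + - ((1 / \<theta>) *\<^sub>R v) \<bullet> x' - \<phi> x x'
      \<le> (v \<bullet> z - v \<bullet> z' + g z) / \<theta>" .
  qed
  \<comment> \<open>The term of the conjugate at the origin is 0, and \<open>J_le\<close> bounds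
    \<open>J\<close> from above; hence \<open>J\<close> is a real number.\<close>
  have "ereal 0 \<le> J"
    using joint_conjugate_upper[of "(1 / \<theta>) *\<^sub>R v" 0 "- ((1 / \<theta>) *\<^sub>R v)" 0 \<phi>] \<phi>(2)
    by (simp add: J_def)
  then obtain j where j: "J = ereal j" using J_le[OF c] by (cases J) auto

  \<comment> \<open>Compactness of \<open>Z1\<close> makes the support function an attained real
    value. The corresponding point \<open>z0\<close> maximises \<open>v \<bullet> z'\<close> over
    \<open>Y\<close>, so \<open>z' = z0\<close> is where \<open>J_le\<close> is strongest.\<close>
  have "continuous_on Z1 (\<lambda>\<zeta>. (transpose A1 *v v) \<bullet> \<zeta>)" by (intro continuous_intros)
  then obtain \<zeta>0 where \<zeta>0: "\<zeta>0 \<in> Z1" "\<And>\<zeta>. \<zeta> \<in> Z1 \<Longrightarrow> (transpose A1 *v v) \<bullet> \<zeta> \<le> (transpose A1 *v v) \<bullet> \<zeta>0"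
    using continuous_attains_sup[OF Z1(3,1)] by blast
  have S1: "support_function Z1 (transpose A1 *v v) = ereal ((transpose A1 *v v) \<bullet> \<zeta>0)"
    unfolding support_function_def using \<zeta>0 by (intro antisym SUP_least SUP_upper) auto
  define z0 where "z0 = x1 + A1 *v \<zeta>0"
  have "z0 \<in> Y" using \<zeta>0 by (simp add: z0_def Y_def)
  have D: "x1 \<bullet> v + (transpose A1 *v v) \<bullet> \<zeta>0 = v \<bullet> z0"
    unfolding inner_transpose_matrix by (simp add: z0_def inner_add_right inner_commute)
  \<comment> \<open>The affine part of \<open>J_le\<close> at \<open>z' = z0\<close>, with the norm
    term split off to play the part of \<open>F\<close> in the second separation.\<close>
  define g2 where "g2 z = v \<bullet> z - a \<bullet> z - b + s - \<theta> * j - v \<bullet> z0" for z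
  have "convex_on \<Xi> g2"
  proof (rule convex_onI[OF _ cvx(2)])
    fix t x y assume "(0::real) < t" "t < 1"
    have "g2 ((1 - t) *\<^sub>R x + t *\<^sub>R y) = (1 - t) * g2 x + t * g2 y"
      by (simp add: g2_def algebra_simps)
    then show "g2 ((1 - t) *\<^sub>R x + t *\<^sub>R y) \<le> (1 - t) * g2 x + t * g2 y" by simp
  qed
  moreover have "0 \<le> lam * nrm (z - xh) + g2 z" if "z \<in> \<Xi>" for z
    using J_le[OF that \<open>z0 \<in> Y\<close>] \<theta> by (simp add: j g2_def g_def field_simps)
  ultimately obtain q where q: "\<And>x z. z \<in> \<Xi> \<Longrightarrow> q \<bullet> x - lam * nrm (x - xh) \<le> q \<bullet> z + g2 z"
    using fenchel_separation[OF N _ ne(2)] by blast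
  \<comment> \<open>Chosen so that \<open>v + w - a = - q\<close>: the dual norm constraint becomes
    a bound on the slope found by the second separation.\<close>
  define w where "w = a - v - q"
  have dual: "dual_norm nrm (v + w - a) \<le> lam"
  proof (rule dual_norm_le[OF nrm lam])
    fix y
    \<comment> \<open>Along the ray \<open>xh - t *\<^sub>R y\<close> the left-hand side of
      \<open>q\<close> equals \<open>q \<bullet> xh + t * e\<close>; as it stays bounded for
      \<open>t \<ge> 0\<close>, \<open>e\<close> cannot be positive.\<close>
    define e where "e = - (q \<bullet> y) - lam * nrm y"
    define B where "B = q \<bullet> c + g2 c - q \<bullet> xh"
    have "e \<le> 0"
    proof (rule ccontr)
      assume "\<not> e \<le> 0"
      have "t * e \<le> B" if "t \<ge> 0" for t
        using q[OF c(1), of "xh - t *\<^sub>R y"] that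
        by (simp add: e_def B_def is_norm_minus[OF nrm] is_norm_scale[OF nrm] algebra_simps)
      from this[of "(\<bar>B\<bar> + 1) / e"] \<open>\<not> e \<le> 0\<close> show False by simp
    qed
    then show "(v + w - a) \<bullet> y \<le> lam * nrm y" by (simp add: w_def e_def)
  qed
  have S2: "support_function Z2 (transpose A *v w)
      \<le> ereal (s - b - \<theta> * j - v \<bullet> z0 - q \<bullet> xh - x0 \<bullet> w)"
    unfolding support_function_def
  proof (rule SUP_least)
    fix \<eta> assume "\<eta> \<in> Z2"
    \<comment> \<open>At \<open>x = xh\<close> the norm term vanishes, and the separation inequality
      becomes an upper bound for \<open>w\<close> on \<Xi>.\<close>
    then have "x0 + A *v \<eta> \<in> \<Xi>" by (simp add: \<Xi>_def)
    from q[OF this, of xh] have "w \<bullet> (x0 + A *v \<eta>) \<le> s - b - \<theta> * j - v \<bullet> z0 - q \<bullet> xh"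
      by (simp add: is_norm_zero[OF nrm] g2_def w_def inner_diff_left)
    then show "ereal ((transpose A *v w) \<bullet> \<eta>) \<le> ereal (s - b - \<theta> * j - v \<bullet> z0 - q \<bullet> xh - x0 \<bullet> w)"
      unfolding inner_transpose_matrix by (simp add: inner_add_right inner_commute)
  qed
  have "ereal (x1 \<bullet> v) + support_function Z1 (transpose A1 *v v)
        + ereal (x0 \<bullet> w) + support_function Z2 (transpose A *v w)
        + ereal (- (xh \<bullet> (v + w - a)) + b - s)
        + ereal \<theta> * joint_conjugate \<phi> ((1 / \<theta>) *\<^sub>R v) (- ((1 / \<theta>) *\<^sub>R v))
      \<le> ereal (x1 \<bullet> v) + ereal ((transpose A1 *v v) \<bullet> \<zeta>0) + ereal (x0 \<bullet> w)
        + ereal (s - b - \<theta> * j - v \<bullet> z0 - q \<bullet> xh - x0 \<bullet> w)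
        + ereal (- (xh \<bullet> (v + w - a)) + b - s) + ereal \<theta> * ereal j"
    unfolding J_def[symmetric] j S1 by (intro add_mono order_refl S2)
  also have "\<dots> = ereal 0"
  proof -
    have "xh \<bullet> (v + w - a) = - (q \<bullet> xh)" by (simp add: w_def inner_commute)
    with D show ?thesis by simp
  qed
  finally show ?thesis using dual unfolding zero_ereal_def by blast
qed

text \<open>Partial minimisation preserves joint convexity, and a finite convex function on the
  whole space is continuous; nonnegativity keeps the real infimum meaningful. Measurability of the
  integrand rests on this.\<close>

lemma continuous_on_partial_Inf:
  fixes \<phi> :: "'v::euclidean_space \<Rightarrow> 'w::real_vector \<Rightarrow> real"
  assumes \<phi>: "convex_on UNIV (\<lambda>(z, z'). \<phi> z z')" "\<And>z z'. 0 \<le> \<phi> z z'"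
    and Y: "Y \<noteq> {}" "convex Y"
  shows "continuous_on UNIV (\<lambda>z. INF z'\<in>Y. \<phi> z z')"
proof (rule convex_on_continuous[OF open_UNIV convex_onI])
  fix t :: real and x y :: 'v
  assume t: "0 < t" "t < 1"
  have bdd: "bdd_below (\<phi> z ` Y)" for z using \<phi>(2) by (intro bdd_belowI[of _ 0]) auto
  let ?\<psi> = "\<lambda>z. INF z'\<in>Y. \<phi> z z'"
  show "?\<psi> ((1 - t) *\<^sub>R x + t *\<^sub>R y) \<le> (1 - t) * ?\<psi> x + t * ?\<psi> y"
  proof (rule field_le_epsilon)
    fix e :: real assume "e > 0"
    \<comment> \<open>The infima need not be attained, so points that are optimal up to
      \<open>e\<close> are combined convexly.\<close>
    have "\<exists>x'\<in>Y. \<phi> x x' < ?\<psi> x + e" "\<exists>y'\<in>Y. \<phi> y y' < ?\<psi> y + e"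
      using \<open>e > 0\<close> Y(1) bdd by (simp_all add: cINF_less_iff[symmetric])
    then obtain x' y' where *: "x' \<in> Y" "\<phi> x x' < ?\<psi> x + e" "y' \<in> Y" "\<phi> y y' < ?\<psi> y + e" by blast
    have "?\<psi> ((1 - t) *\<^sub>R x + t *\<^sub>R y) \<le> \<phi> ((1 - t) *\<^sub>R x + t *\<^sub>R y) ((1 - t) *\<^sub>R x' + t *\<^sub>R y')"
      using * t Y(2) by (intro cINF_lower bdd) (auto simp: convexD)
    also have "\<dots> \<le> (1 - t) * \<phi> x x' + t * \<phi> y y'"
      using convex_onD[OF \<phi>(1), of t "(x, x')" "(y, y')"] t by simp
    also have "\<dots> \<le> (1 - t) * (?\<psi> x + e) + t * (?\<psi> y + e)"
      using * t by (intro add_mono mult_left_mono) auto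
    finally show "?\<psi> ((1 - t) *\<^sub>R x + t *\<^sub>R y) \<le> (1 - t) * ?\<psi> x + t * ?\<psi> y + e"
      by (simp add: algebra_simps)
  qed
qed auto

section \<open>Extended expectations and empirical measures\<close>

lemma ext_expectation_integrable:
  assumes "integrable M f" shows "ext_expectation M f = ereal (\<integral>x. f x \<partial>M)"
proof -
  obtain a b where "a \<ge> 0" "(\<integral>\<^sup>+ x. ennreal (f x) \<partial>M) = ennreal a"
    "b \<ge> 0" "(\<integral>\<^sup>+ x. ennreal (- f x) \<partial>M) = ennreal b"
    using assms by (metis ennreal_cases infinity_ennreal_def real_integrable_def)
  then show ?thesis
    by (simp add: ext_expectation_def real_lebesgue_integral_def[OF assms] enn2ereal_ennreal)
qed

text \<open>The bound makes the positive part of \<open>f\<close> integrable. If the negative part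
  has finite integral too, ordinary monotonicity applies; otherwise the expectation is
  -\<infinity>.\<close>

lemma ext_expectation_le_integral:
  assumes [measurable]: "f \<in> borel_measurable M" and u: "integrable M u"
    and le: "\<And>x. x \<in> space M \<Longrightarrow> f x \<le> u x"
  shows "ext_expectation M f \<le> ereal (\<integral>x. u x \<partial>M)"
proof -
  let ?A = "\<integral>\<^sup>+ x. ennreal (f x) \<partial>M" and ?B = "\<integral>\<^sup>+ x. ennreal (- f x) \<partial>M"
  let ?U = "\<integral>\<^sup>+ x. ennreal (u x) \<partial>M" and ?W = "\<integral>\<^sup>+ x. ennreal (- u x) \<partial>M"
  have [measurable]: "u \<in> borel_measurable M" using u by auto
  have "?A \<le> ?U" by (intro nn_integral_mono ennreal_leI le)
  moreover have fin: "?U \<noteq> \<infinity>" "?W \<noteq> \<infinity>" using u by (auto simp: real_integrable_def)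
  ultimately obtain A where A: "A \<ge> 0" "?A = ennreal A"
    by (cases ?A) (auto simp: top_unique)
  show ?thesis
  proof (cases ?B)
    case (real B)
    have "integrable M f" using real A by (auto simp: real_integrable_def)
    then show ?thesis
      using integral_mono[OF \<open>integrable M f\<close> u le] by (simp add: ext_expectation_integrable)
  next
    case top
    then show ?thesis using A by (simp add: ext_expectation_def enn2ereal_ennreal)
  qed
qed

text \<open>
  A measurable map into \<open>borel_on \<Xi>\<close> takes all its values in \<open>\<Xi>\<close>, whereas a measure on a
  pmf lives on the whole type; \<open>clamp_to\<close> repairs the map outside the support.
\<close>

definition clamp_to :: "'v set \<Rightarrow> 'v \<Rightarrow> 'v \<Rightarrow> 'v" where
  "clamp_to S c z = (if z \<in> S then z else c)"

lemma measurable_clamp_to: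
  assumes "c \<in> \<Xi>"
  shows "(\<lambda>z. clamp_to \<Xi> c (g z)) \<in> measurable (measure_pmf p) (borel_on \<Xi>)"
  using assms by (auto simp: clamp_to_def space_restrict_space)

text \<open>As a push-forward of a uniform pmf, the empirical measure turns integrals into finite
  averages over the samples.\<close>

lemma empirical_measure_eq_distr:
  fixes \<Xi> :: "'v::euclidean_space set"
  assumes N: "N \<ge> 1" and \<xi>h: "\<forall>j\<in>{1..N}. \<xi>h j \<in> \<Xi>" and c: "c \<in> \<Xi>"
  shows "empirical_measure \<Xi> N \<xi>h
    = distr (map_pmf \<xi>h (pmf_of_set {1..N})) (borel_on \<Xi>) (clamp_to \<Xi> c)" (is "_ = ?Q")
proof -
  have eq: "emeasure ?Q B
      = ennreal (1 / real N) * (\<Sum>j=1..N. emeasure (return (borel_on \<Xi>) (\<xi>h j)) B)"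
    if B: "B \<in> sets (borel_on \<Xi>)" for B
  proof -
    have "emeasure ?Q B = emeasure (map_pmf \<xi>h (pmf_of_set {1..N})) (clamp_to \<Xi> c -` B)"
      using B measurable_clamp_to[OF c, of "\<lambda>z. z"] by (subst emeasure_distr) auto
    also have "\<dots> = emeasure (pmf_of_set {1..N}) (\<xi>h -` clamp_to \<Xi> c -` B)" by simp
    also have "\<dots> = (\<integral>\<^sup>+ j. indicator (\<xi>h -` clamp_to \<Xi> c -` B) j \<partial>pmf_of_set {1..N})"
      by simp
    also have "\<dots> = (\<Sum>j=1..N. indicator (\<xi>h -` clamp_to \<Xi> c -` B) j) / of_nat (card {1..N})"
      using N by (subst nn_integral_pmf_of_set) (auto simp: ennreal_of_nat_eq_real_of_nat)
    also have "(\<Sum>j=1..N. indicator (\<xi>h -` clamp_to \<Xi> c -` B) j :: ennreal)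
        = (\<Sum>j=1..N. emeasure (return (borel_on \<Xi>) (\<xi>h j)) B)"
      using \<xi>h by (intro sum.cong refl) (simp add: emeasure_return[OF B] indicator_def clamp_to_def)
    finally show ?thesis
      using N by (simp add: divide_ennreal_def mult.commute inverse_ennreal
          ennreal_of_nat_eq_real_of_nat inverse_eq_divide)
  qed
  \<comment> \<open>\<open>measure_of\<close> depends only on the values on measurable sets, where
    the defining formula agrees with \<open>?Q\<close>; rebuilding \<open>?Q\<close> from its own
    data returns \<open>?Q\<close>.\<close>
  have "empirical_measure \<Xi> N \<xi>h = measure_of \<Xi> (sets (borel_on \<Xi>)) (emeasure ?Q)"
    unfolding empirical_measure_def
  proof (rule measure_of_eq)
    show "sets (borel_on \<Xi>) \<subseteq> Pow \<Xi>"
      using sets.space_closed[of "borel_on \<Xi>"] by (simp only: space_restrict_space space_borel Int_UNIV_right)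
    fix B assume "B \<in> sigma_sets \<Xi> (sets (borel_on \<Xi>))"
    then have "B \<in> sets (borel_on \<Xi>)"
      using sets.sigma_sets_eq[of "borel_on \<Xi>"] by (simp only: space_restrict_space space_borel Int_UNIV_right)
    then show "ennreal (1 / real N) * (\<Sum>j=1..N. emeasure (return (borel_on \<Xi>) (\<xi>h j)) B) = emeasure ?Q B"
      by (rule eq[symmetric])
  qed
  also have "\<dots> = measure_of (space ?Q) (sets ?Q) (emeasure ?Q)"
    by (simp only: space_distr sets_distr space_restrict_space space_borel Int_UNIV_right)
  finally show ?thesis by (simp only: measure_of_of_measure)
qed

text \<open>The coordinates of a selection vary independently. Freezing all but one at
  \<open>c\<close> bounds each family, and near-maximisers chosen coordinatewise reach the sum of
  the suprema up to an arbitrary error.\<close>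

lemma sum_cSUP_le:
  fixes F :: "'i \<Rightarrow> 'a \<Rightarrow> real"
  assumes I: "finite I" and S: "S \<noteq> {}"
    and le: "\<And>z. z \<in> I \<rightarrow> S \<Longrightarrow> (\<Sum>i\<in>I. F i (z i)) \<le> B"
  shows "\<forall>i\<in>I. bdd_above (F i ` S)" "(\<Sum>i\<in>I. SUP x\<in>S. F i x) \<le> B"
proof -
  obtain c where c: "c \<in> S" using S by blast
  show bdd: "\<forall>i\<in>I. bdd_above (F i ` S)"
  proof
    fix i assume i: "i \<in> I"
    show "bdd_above (F i ` S)"
    proof (rule bdd_aboveI2)
      fix x assume "x \<in> S"
      then have "(\<Sum>l\<in>I. F l (((\<lambda>_. c)(i := x)) l)) \<le> B" using c by (intro le) auto
      also have "(\<Sum>l\<in>I. F l (((\<lambda>_. c)(i := x)) l)) = F i x + (\<Sum>l\<in>I - {i}. F l c)"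
        using I i by (subst sum.remove[of _ i]) (auto intro!: sum.cong)
      finally show "F i x \<le> B - (\<Sum>l\<in>I - {i}. F l c)" by simp
    qed
  qed
  show "(\<Sum>i\<in>I. SUP x\<in>S. F i x) \<le> B"
  proof (rule field_le_epsilon)
    fix e :: real assume e: "e > 0"
    \<comment> \<open>The error \<open>e\<close> is spread over the indices; the \<open>+ 1\<close>
      covers an empty \<open>I\<close>.\<close>
    define d where "d = e / (real (card I) + 1)"
    have d: "d > 0" "real (card I) * d \<le> e" using e by (auto simp: d_def field_simps)
    have "\<exists>x\<in>S. (SUP x\<in>S. F i x) - d < F i x" if "i \<in> I" for i
      using bdd that S d(1) by (subst less_cSUP_iff[symmetric]) auto
    then obtain z where z: "\<And>i. i \<in> I \<Longrightarrow> z i \<in> S \<and> (SUP x\<in>S. F i x) - d < F i (z i)" by metis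
    have "(\<Sum>i\<in>I. (SUP x\<in>S. F i x) - d) \<le> (\<Sum>i\<in>I. F i (z i))"
      using z by (intro sum_mono) (auto intro: less_imp_le)
    also have "\<dots> \<le> B" using z by (intro le) auto
    finally show "(\<Sum>i\<in>I. SUP x\<in>S. F i x) \<le> B + e" using d(2) by (simp add: sum_subtractf)
  qed
qed

section \<open>Duality over the Wasserstein ball\<close>

lemma borel_measurable_is_norm:
  fixes nrm :: "'v::euclidean_space \<Rightarrow> real"
  assumes "is_norm nrm" shows "nrm \<in> borel_measurable borel"
  by (intro borel_measurable_continuous_onI continuous_on_is_norm assms)

text \<open>The inclusion of \<Xi> into the whole space is measurable for the trace
  \<sigma>-algebra, so Borel functions on the whole space can be composed with both coordinates of a
  coupling.\<close>

lemma measurable_coupling_projections: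
  assumes "sets P = sets (borel_on \<Xi>)" "sets Q = sets (borel_on \<Xi>)" "sets \<gamma> = sets (P \<Otimes>\<^sub>M Q)"
  shows "fst \<in> \<gamma> \<rightarrow>\<^sub>M borel" "snd \<in> \<gamma> \<rightarrow>\<^sub>M borel"
    "fst \<in> \<gamma> \<rightarrow>\<^sub>M P" "snd \<in> \<gamma> \<rightarrow>\<^sub>M Q"
proof -
  show *: "fst \<in> \<gamma> \<rightarrow>\<^sub>M P" "snd \<in> \<gamma> \<rightarrow>\<^sub>M Q"
    using measurable_fst measurable_snd by (simp_all add: measurable_cong_sets[OF assms(3) refl])
  have "(\<lambda>x. x) \<in> borel_on \<Xi> \<rightarrow>\<^sub>M borel" by (intro measurable_restrict_space1) simp
  then have "(\<lambda>x. x) \<in> P \<rightarrow>\<^sub>M borel" "(\<lambda>x. x) \<in> Q \<rightarrow>\<^sub>M borel"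
    using assms by (simp_all cong: measurable_cong_sets)
  with * show "fst \<in> \<gamma> \<rightarrow>\<^sub>M borel" "snd \<in> \<gamma> \<rightarrow>\<^sub>M borel"
    using measurable_compose by fastforce+
qed

lemma expectation_map_pmf_of_set:
  fixes F :: "'a \<Rightarrow> real"
  assumes "N \<ge> (1::nat)"
  shows "measure_pmf.expectation (map_pmf g (pmf_of_set {1..N})) F = 1 / real N * (\<Sum>j=1..N. F (g j))"
  using assms by (simp add: integral_pmf_of_set)

text \<open>A bound \<open>f z \<le> g y + lam * nrm (z - y)\<close> is integrated over a nearly
  optimal coupling: the norm term contributes at most \<open>lam * r\<close> up to a small error,
  and \<open>g\<close> at most the average of the \<open>s j\<close>.\<close>

lemma ext_expectation_le_dual_objective:
  fixes nrm :: "'v::euclidean_space \<Rightarrow> real"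
  assumes nrm: "is_norm nrm" and N: "N \<ge> 1" and \<xi>h: "\<forall>j\<in>{1..N}. \<xi>h j \<in> \<Xi>"
    and f: "f \<in> borel_measurable borel" and r: "r \<ge> 0" and lam: "lam \<ge> 0"
    and le: "\<And>j z. j \<in> {1..N} \<Longrightarrow> z \<in> \<Xi> \<Longrightarrow> f z \<le> s j + lam * nrm (z - \<xi>h j)"
    and P: "P \<in> wasserstein_ball nrm \<Xi> N \<xi>h r"
  shows "ext_expectation P f \<le> ereal (lam * r + 1 / real N * (\<Sum>j=1..N. s j))"
proof (rule ereal_le_epsilon2)
  fix e :: real assume e: "e > 0"
  \<comment> \<open>The infimum defining the Wasserstein distance need not be attained, so a cost up
    to \<open>r + d\<close> is allowed; \<open>lam + 1\<close> keeps \<open>d\<close> positive when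
    \<open>lam = 0\<close>.\<close>
  define d where "d = e / (lam + 1)"
  have d: "d > 0" "lam * d \<le> e" using e lam by (auto simp: d_def field_simps)
  define Q where "Q = empirical_measure \<Xi> N \<xi>h"
  have Q_eq: "Q = distr (map_pmf \<xi>h (pmf_of_set {1..N})) (borel_on \<Xi>) (clamp_to \<Xi> (\<xi>h 1))"
    unfolding Q_def using N \<xi>h by (intro empirical_measure_eq_distr) auto
  have sets: "sets P = sets (borel_on \<Xi>)" "sets Q = sets (borel_on \<Xi>)"
    using P by (simp_all add: wasserstein_ball_def prob_measures_def Q_eq)
  then have space: "space P = \<Xi>"
    using sets_eq_imp_space_eq[OF sets(1)] by (simp add: space_restrict_space)
  have "wasserstein nrm P Q \<le> ennreal r" using P by (simp add: wasserstein_ball_def Q_def)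
  also have "\<dots> < ennreal (r + d)" using d r by (simp add: ennreal_lessI)
  finally obtain \<gamma> where \<gamma>: "\<gamma> \<in> couplings P Q"
      "(\<integral>\<^sup>+ p. ennreal (nrm (fst p - snd p)) \<partial>\<gamma>) < ennreal (r + d)"
    unfolding wasserstein_def by (auto simp: INF_less_iff case_prod_unfold)
  then have \<gamma>_marg: "sets \<gamma> = sets (P \<Otimes>\<^sub>M Q)" "distr \<gamma> P fst = P" "distr \<gamma> Q snd = Q"
    by (auto simp: couplings_def)
  note [measurable] = f borel_measurable_is_norm[OF nrm] measurable_coupling_projections[OF sets \<gamma>_marg(1)]
  have fP: "g \<in> borel_measurable P" "g \<in> borel_measurable Q"
    if "g \<in> borel_measurable borel" for g :: "'v \<Rightarrow> real"
    using measurable_restrict_space1[OF that, of \<Xi>] sets by (simp_all cong: measurable_cong_sets)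
  have cost: "integrable \<gamma> (\<lambda>p. nrm (fst p - snd p))"
    using \<gamma>(2) by (intro integrableI_nonneg)
      (auto simp: is_norm_nonneg[OF nrm] intro: order.strict_trans)
  have "ennreal (\<integral>p. nrm (fst p - snd p) \<partial>\<gamma>) < ennreal (r + d)"
    using \<gamma>(2) nn_integral_eq_integral[OF cost] by (simp add: is_norm_nonneg[OF nrm])
  then have cost_le: "(\<integral>p. nrm (fst p - snd p) \<partial>\<gamma>) \<le> r + d"
    by (simp add: ennreal_less_iff is_norm_nonneg[OF nrm])

  \<comment> \<open>The bounds on \<open>f\<close> are indexed by \<open>j\<close>, but the second
    coordinate of a coupling carries no index. Their minimum is index-free and is at most
    \<open>s j\<close> at \<open>\<xi>h j\<close>, even if samples coincide.\<close>
  define g where "g y = Min ((\<lambda>j. s j + lam * nrm (y - \<xi>h j)) ` {1..N})" for y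
  have g_meas: "g \<in> borel_measurable borel" unfolding g_def by measurable
  have g_le: "g (\<xi>h j) \<le> s j" if "j \<in> {1..N}" for j
    unfolding g_def using that by (intro Min.coboundedI) (auto simp: is_norm_zero[OF nrm] intro!: image_eqI[of _ _ j])
  \<comment> \<open>The triangle inequality through \<open>y\<close> is applied to each bound before
    taking the minimum over \<open>j\<close>.\<close>
  have f_le: "f z \<le> g y + lam * nrm (z - y)" if z: "z \<in> \<Xi>" for z y
  proof -
    have "f z - lam * nrm (z - y) \<le> s j + lam * nrm (y - \<xi>h j)" if "j \<in> {1..N}" for j
      using le[OF that z] mult_left_mono[OF is_norm_diff_triangle[OF nrm, of z "\<xi>h j" y] lam]
      by (simp add: distrib_left)
    then have "f z - lam * nrm (z - y) \<le> g y"
      unfolding g_def using N by (subst Min_ge_iff) auto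
    then show ?thesis by simp
  qed
  have clamp: "(clamp_to \<Xi> (\<xi>h 1)) \<in> measure_pmf (map_pmf \<xi>h (pmf_of_set {1..N})) \<rightarrow>\<^sub>M borel_on \<Xi>"
    using N \<xi>h by (intro measurable_clamp_to[where g = "\<lambda>z. z"]) auto
  note g_meas' = measurable_restrict_space1[OF g_meas]
  have "integrable (measure_pmf (map_pmf \<xi>h (pmf_of_set {1..N}))) (\<lambda>y. g (clamp_to \<Xi> (\<xi>h 1) y))"
    using N by (intro integrable_measure_pmf_finite) auto
  then have gQ: "integrable Q g"
    unfolding Q_eq by (simp only: integrable_distr_eq[OF clamp g_meas'])
  have "(\<integral>y. g y \<partial>Q) = (\<integral>y. g (clamp_to \<Xi> (\<xi>h 1) y) \<partial>map_pmf \<xi>h (pmf_of_set {1..N}))"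
    unfolding Q_eq by (rule integral_distr[OF clamp g_meas'])
  also have "\<dots> = 1 / real N * (\<Sum>j=1..N. g (clamp_to \<Xi> (\<xi>h 1) (\<xi>h j)))"
    by (rule expectation_map_pmf_of_set[OF N])
  also have "\<dots> \<le> 1 / real N * (\<Sum>j=1..N. s j)"
    using g_le \<xi>h by (intro mult_left_mono sum_mono) (auto simp: clamp_to_def)
  finally have Q_le: "(\<integral>y. g y \<partial>Q) \<le> 1 / real N * (\<Sum>j=1..N. s j)" .
  note margs = measurable_coupling_projections(3,4)[OF sets \<gamma>_marg(1)]
  have g_int: "integrable \<gamma> (\<lambda>p. g (snd p))" "(\<integral>p. g (snd p) \<partial>\<gamma>) = (\<integral>y. g y \<partial>Q)"
    using gQ integrable_distr_eq[OF margs(2) fP(2)[OF g_meas]]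
      integral_distr[OF margs(2) fP(2)[OF g_meas]] unfolding \<gamma>_marg(3) by simp_all

  have "ext_expectation P f = ext_expectation (distr \<gamma> P fst) f" by (simp add: \<gamma>_marg)
  also have "\<dots> = ext_expectation \<gamma> (\<lambda>p. f (fst p))"
    unfolding ext_expectation_def using fP(1)[OF f]
    by (simp add: nn_integral_distr[OF margs(1)])
  also have "\<dots> \<le> ereal (\<integral>p. g (snd p) + lam * nrm (fst p - snd p) \<partial>\<gamma>)"
  proof (rule ext_expectation_le_integral)
    show "integrable \<gamma> (\<lambda>p. g (snd p) + lam * nrm (fst p - snd p))" using g_int cost by simp
    fix p assume "p \<in> space \<gamma>"
    then have "fst p \<in> \<Xi>" using measurable_space[OF margs(1)] space by auto
    then show "f (fst p) \<le> g (snd p) + lam * nrm (fst p - snd p)" by (rule f_le)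
  qed measurable
  also have "(\<integral>p. g (snd p) + lam * nrm (fst p - snd p) \<partial>\<gamma>)
      = (\<integral>y. g y \<partial>Q) + lam * (\<integral>p. nrm (fst p - snd p) \<partial>\<gamma>)"
    using g_int cost by simp
  also have "\<dots> \<le> 1 / real N * (\<Sum>j=1..N. s j) + lam * (r + d)"
    by (intro add_mono Q_le mult_left_mono cost_le lam)
  also have "\<dots> \<le> lam * r + 1 / real N * (\<Sum>j=1..N. s j) + e" using d by (simp add: distrib_left)
  finally show "ext_expectation P f \<le> ereal (lam * r + 1 / real N * (\<Sum>j=1..N. s j)) + ereal e" by simp
qed

section \<open>Finitely supported transport plans\<close>

definition finite_plans :: "'v set \<Rightarrow> nat \<Rightarrow> (nat \<Rightarrow> 'v) \<Rightarrow> ('v \<times> 'v) pmf set" where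
  "finite_plans \<Xi> N \<xi>h = {\<pi>. finite (set_pmf \<pi>) \<and> set_pmf \<pi> \<subseteq> \<Xi> \<times> \<Xi>
     \<and> map_pmf snd \<pi> = map_pmf \<xi>h (pmf_of_set {1..N})}"

text \<open>A Bernoulli mixture keeps the common second marginal, and expectations are affine in the
  weight; this yields convexity of the set of (cost, value) pairs.\<close>

lemma finite_plans_mix:
  assumes "\<pi> \<in> finite_plans \<Xi> N \<xi>h" "\<rho> \<in> finite_plans \<Xi> N \<xi>h" "0 \<le> t" "t \<le> 1"
  obtains \<sigma> where "\<sigma> \<in> finite_plans \<Xi> N \<xi>h"
    "\<And>F :: _ \<Rightarrow> real. measure_pmf.expectation \<sigma> F
      = t * measure_pmf.expectation \<pi> F + (1 - t) * measure_pmf.expectation \<rho> F"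
proof -
  define \<sigma> where "\<sigma> = bernoulli_pmf t \<bind> (\<lambda>b. if b then \<pi> else \<rho>)"
  have fin: "finite (set_pmf \<pi>)" "finite (set_pmf \<rho>)" using assms by (auto simp: finite_plans_def)
  have "map_pmf snd \<sigma> = bernoulli_pmf t \<bind> (\<lambda>b. map_pmf \<xi>h (pmf_of_set {1..N}))"
    unfolding \<sigma>_def map_bind_pmf using assms
    by (intro bind_pmf_cong) (auto simp: finite_plans_def)
  then have "map_pmf snd \<sigma> = map_pmf \<xi>h (pmf_of_set {1..N})" by simp
  moreover have "set_pmf \<sigma> \<subseteq> set_pmf \<pi> \<union> set_pmf \<rho>"
    by (auto simp: \<sigma>_def set_bind_pmf split: if_splits)
  ultimately have "\<sigma> \<in> finite_plans \<Xi> N \<xi>h"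
    using assms fin unfolding finite_plans_def by (auto intro: finite_subset)
  moreover have "measure_pmf.expectation \<sigma> F
      = t * measure_pmf.expectation \<pi> F + (1 - t) * measure_pmf.expectation \<rho> F" for F :: "_ \<Rightarrow> real"
    unfolding \<sigma>_def using assms fin
    by (subst pmf_expectation_bind[where A = UNIV]) (auto simp: UNIV_bool)
  ultimately show thesis by (rule that)
qed

text \<open>The plan that moves the j-th sample to \<open>z j\<close>. Such plans extract pointwise
  bounds from the separating hyperplane.\<close>

lemma finite_plans_selection:
  assumes "N \<ge> 1" "\<forall>j\<in>{1..N}. \<xi>h j \<in> \<Xi> \<and> z j \<in> \<Xi>"
  shows "map_pmf (\<lambda>j. (z j, \<xi>h j)) (pmf_of_set {1..N}) \<in> finite_plans \<Xi> N \<xi>h"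
proof -
  have "{1..N} \<noteq> {}" using assms(1) by simp
  then have "set_pmf (pmf_of_set {1..N}) = {1..N}" by (rule set_pmf_of_set) simp
  then show ?thesis
    using assms(2) unfolding finite_plans_def by (simp add: image_subset_iff pmf.map_comp comp_def del: One_nat_def)
qed

text \<open>The clamped coordinates push the plan, a pmf on the whole product type, forward to
  \<open>P\<close>, to the empirical measure and to a coupling of the two. Clamping is the identity
  on the support, so cost and value do not change.\<close>

lemma finite_plan_in_wasserstein_ball:
  fixes nrm :: "'v::euclidean_space \<Rightarrow> real"
  assumes nrm: "is_norm nrm" and N: "N \<ge> 1" and \<xi>h: "\<forall>j\<in>{1..N}. \<xi>h j \<in> \<Xi>"
    and f: "f \<in> borel_measurable borel"
    and \<pi>: "\<pi> \<in> finite_plans \<Xi> N \<xi>h"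
    and cost: "measure_pmf.expectation \<pi> (\<lambda>p. nrm (fst p - snd p)) \<le> r"
  obtains P where "P \<in> wasserstein_ball nrm \<Xi> N \<xi>h r"
    "ext_expectation P f = ereal (measure_pmf.expectation \<pi> (\<lambda>p. f (fst p)))"
proof -
  have c: "\<xi>h 1 \<in> \<Xi>" using N \<xi>h by auto
  let ?cl = "clamp_to \<Xi> (\<xi>h 1)"
  have fin: "finite (set_pmf \<pi>)" and sub: "set_pmf \<pi> \<subseteq> \<Xi> \<times> \<Xi>"
    and snd: "map_pmf snd \<pi> = map_pmf \<xi>h (pmf_of_set {1..N})"
    using \<pi> by (auto simp: finite_plans_def)
  define P where "P = distr \<pi> (borel_on \<Xi>) (\<lambda>p. ?cl (fst p))"
  define Q where "Q = distr \<pi> (borel_on \<Xi>) (\<lambda>p. ?cl (snd p))"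
  define \<gamma> where "\<gamma> = distr \<pi> (P \<Otimes>\<^sub>M Q) (\<lambda>p. (?cl (fst p), ?cl (snd p)))"
  have Q: "empirical_measure \<Xi> N \<xi>h = Q"
  proof -
    have "empirical_measure \<Xi> N \<xi>h = distr (map_pmf snd \<pi>) (borel_on \<Xi>) ?cl"
      unfolding snd by (intro empirical_measure_eq_distr N \<xi>h c)
    also have "\<dots> = Q"
      unfolding map_pmf_rep_eq Q_def using c
      by (subst distr_distr) (auto simp: comp_def clamp_to_def space_restrict_space)
    finally show ?thesis .
  qed
  have sets: "sets P = sets (borel_on \<Xi>)" "sets Q = sets (borel_on \<Xi>)" by (simp_all add: P_def Q_def)
  note cl = measurable_clamp_to[OF c]
  have clPQ: "(\<lambda>p. ?cl (fst p)) \<in> measure_pmf \<pi> \<rightarrow>\<^sub>M P" "(\<lambda>p. ?cl (snd p)) \<in> measure_pmf \<pi> \<rightarrow>\<^sub>M Q"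
    using cl by (simp_all add: measurable_cong_sets[OF refl sets(1)] measurable_cong_sets[OF refl sets(2)])
  then have clp: "(\<lambda>p. (?cl (fst p), ?cl (snd p))) \<in> measure_pmf \<pi> \<rightarrow>\<^sub>M P \<Otimes>\<^sub>M Q"
    by (rule measurable_Pair)
  have ident: "?cl (fst p) = fst p" "?cl (snd p) = snd p" if "p \<in> set_pmf \<pi>" for p
    using that sub by (auto simp: clamp_to_def)
  have ex: "integrable P g" "(\<integral>z. g z \<partial>P) = measure_pmf.expectation \<pi> (\<lambda>p. g (fst p))"
    if "g \<in> borel_measurable borel" for g :: "'v \<Rightarrow> real"
  proof -
    have g: "g \<in> borel_measurable (borel_on \<Xi>)" using that by (rule measurable_restrict_space1)
    show "integrable P g"
      unfolding P_def using fin by (subst integrable_distr_eq[OF cl g]) (rule integrable_measure_pmf_finite)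
    have "(\<integral>z. g z \<partial>P) = measure_pmf.expectation \<pi> (\<lambda>p. g (?cl (fst p)))"
      unfolding P_def by (rule integral_distr[OF cl g])
    also have "\<dots> = measure_pmf.expectation \<pi> (\<lambda>p. g (fst p))"
      by (intro integral_cong_AE) (simp_all add: AE_measure_pmf_iff ident del: One_nat_def)
    finally show "(\<integral>z. g z \<partial>P) = measure_pmf.expectation \<pi> (\<lambda>p. g (fst p))" .
  qed
  have "P \<in> prob_measures nrm \<Xi>"
    using ex(1)[OF borel_measurable_is_norm[OF nrm]] measure_pmf.prob_space_distr[OF cl]
    by (simp add: prob_measures_def sets) (simp add: P_def)
  moreover have "wasserstein nrm P Q \<le> ennreal r"
  proof -
    have sets_\<gamma>: "sets \<gamma> = sets (P \<Otimes>\<^sub>M Q)" by (simp add: \<gamma>_def)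
    have "\<gamma> \<in> couplings P Q"
      unfolding couplings_def
    proof (intro CollectI conjI sets_\<gamma>)
      show "prob_space \<gamma>" unfolding \<gamma>_def by (rule measure_pmf.prob_space_distr[OF clp])
      show "distr \<gamma> P fst = P"
        unfolding \<gamma>_def using clp by (subst distr_distr) (auto simp: comp_def P_def intro: distr_cong)
      show "distr \<gamma> Q snd = Q"
        unfolding \<gamma>_def using clp by (subst distr_distr) (auto simp: comp_def Q_def intro: distr_cong)
    qed
    then have "wasserstein nrm P Q \<le> (\<integral>\<^sup>+ p. ennreal (nrm (fst p - snd p)) \<partial>\<gamma>)"
      unfolding wasserstein_def case_prod_unfold by (rule INF_lower)
    also have "\<dots> = (\<integral>\<^sup>+ p. ennreal (nrm (?cl (fst p) - ?cl (snd p))) \<partial>\<pi>)"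
    proof -
      note [measurable] = borel_measurable_is_norm[OF nrm]
        measurable_coupling_projections(1,2)[OF sets refl]
      have "(\<lambda>p. ennreal (nrm (fst p - snd p))) \<in> borel_measurable (P \<Otimes>\<^sub>M Q)" by measurable
      then show ?thesis unfolding \<gamma>_def by (subst nn_integral_distr[OF clp]) simp_all
    qed
    also have "\<dots> = (\<integral>\<^sup>+ p. ennreal (nrm (fst p - snd p)) \<partial>\<pi>)"
      by (intro nn_integral_cong_AE) (simp add: AE_measure_pmf_iff ident del: One_nat_def)
    also have "\<dots> = ennreal (measure_pmf.expectation \<pi> (\<lambda>p. nrm (fst p - snd p)))"
      using fin by (intro nn_integral_eq_integral integrable_measure_pmf_finite)
        (auto simp: is_norm_nonneg[OF nrm])
    also have "\<dots> \<le> ennreal r" using cost by (rule ennreal_leI)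
    finally show ?thesis .
  qed
  ultimately have "P \<in> wasserstein_ball nrm \<Xi> N \<xi>h r" by (simp add: wasserstein_ball_def Q)
  then show thesis
    using ext_expectation_integrable[OF ex(1)[OF f]] unfolding ex(2)[OF f] by (rule that)
qed

text \<open>\<open>lam\<close> is the Lagrange multiplier of the transport budget \<open>r\<close>,
  read off as a ratio of the components of the separating normal.\<close>

lemma ex_dual_multiplier:
  fixes nrm :: "'v::euclidean_space \<Rightarrow> real"
  assumes nrm: "is_norm nrm" and N: "N \<ge> 1" and \<xi>h: "\<forall>j\<in>{1..N}. \<xi>h j \<in> \<Xi>"
    and f: "f \<in> borel_measurable borel" and r: "r > 0"
    and V: "\<And>P. P \<in> wasserstein_ball nrm \<Xi> N \<xi>h r \<Longrightarrow> ext_expectation P f \<le> ereal V"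
  obtains lam s where "lam \<ge> 0" "lam * r + 1 / real N * (\<Sum>j=1..N. s j) \<le> V"
    "\<And>j z. j \<in> {1..N} \<Longrightarrow> z \<in> \<Xi> \<Longrightarrow> f z \<le> s j + lam * nrm (z - \<xi>h j)"
proof -
  let ?\<Pi> = "finite_plans \<Xi> N \<xi>h"
  define cost where "cost \<pi> = measure_pmf.expectation \<pi> (\<lambda>p. nrm (fst p - snd p))" for \<pi>
  define val where "val \<pi> = measure_pmf.expectation \<pi> (\<lambda>p. f (fst p))" for \<pi> :: "('v \<times> 'v) pmf"
  have val_le: "val \<pi> \<le> V" if "\<pi> \<in> ?\<Pi>" "cost \<pi> \<le> r" for \<pi>
    using finite_plan_in_wasserstein_ball[OF nrm N \<xi>h f that(1) that(2)[unfolded cost_def]] V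
    by (metis ereal_less_eq(3) val_def)
  define G where "G = (\<lambda>\<pi>. (cost \<pi>, val \<pi>)) ` ?\<Pi>"
  define T where "T = {..r} \<times> {V<..}"
  have "convex G"
  proof (rule convexI)
    fix p q :: "real \<times> real" and u v :: real
    assume *: "p \<in> G" "q \<in> G" "0 \<le> u" "0 \<le> v" "u + v = 1"
    then obtain \<pi> \<rho> where \<pi>\<rho>: "\<pi> \<in> ?\<Pi>" "\<rho> \<in> ?\<Pi>" "p = (cost \<pi>, val \<pi>)" "q = (cost \<rho>, val \<rho>)"
      by (auto simp: G_def)
    have v: "v = 1 - u" "u \<le> 1" using * by auto
    obtain \<sigma> where "\<sigma> \<in> ?\<Pi>" "\<And>F :: _ \<Rightarrow> real. measure_pmf.expectation \<sigma> F
        = u * measure_pmf.expectation \<pi> F + (1 - u) * measure_pmf.expectation \<rho> F"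
      using finite_plans_mix[OF \<pi>\<rho>(1,2) *(3) v(2)] by blast
    then have "u *\<^sub>R p + v *\<^sub>R q = (cost \<sigma>, val \<sigma>)" by (simp add: \<pi>\<rho> v cost_def val_def)
    then show "u *\<^sub>R p + v *\<^sub>R q \<in> G" using \<open>\<sigma> \<in> ?\<Pi>\<close> by (simp add: G_def)
  qed
  moreover have "convex T" unfolding T_def by (intro convex_Times convex_real_interval)
  moreover have "G \<inter> T = {}" using val_le by (fastforce simp: G_def T_def)
  moreover have sel: "map_pmf (\<lambda>j. (z j, \<xi>h j)) (pmf_of_set {1..N}) \<in> ?\<Pi>"
      "cost (map_pmf (\<lambda>j. (z j, \<xi>h j)) (pmf_of_set {1..N})) = 1 / real N * (\<Sum>j=1..N. nrm (z j - \<xi>h j))"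
      "val (map_pmf (\<lambda>j. (z j, \<xi>h j)) (pmf_of_set {1..N})) = 1 / real N * (\<Sum>j=1..N. f (z j))"
    if "\<forall>j\<in>{1..N}. z j \<in> \<Xi>" for z
    unfolding cost_def val_def expectation_map_pmf_of_set[OF N]
    using finite_plans_selection[OF N, of \<xi>h \<Xi> z] that \<xi>h by auto
  define \<pi>0 where "\<pi>0 = map_pmf (\<lambda>j. (\<xi>h j, \<xi>h j)) (pmf_of_set {1..N})"
  have \<pi>0: "\<pi>0 \<in> ?\<Pi>" "cost \<pi>0 = 0"
    unfolding \<pi>0_def using sel[of \<xi>h] \<xi>h by (auto simp: is_norm_zero[OF nrm])
  then have "G \<noteq> {}" by (auto simp: G_def)
  moreover have "(r, V + 1) \<in> T" by (simp add: T_def)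
  ultimately obtain a b where ab: "a \<noteq> 0" "\<forall>x\<in>G. a \<bullet> x \<le> b" "\<forall>x\<in>T. b \<le> a \<bullet> x"
    using separating_hyperplane_sets[of G T] by blast
  obtain \<alpha> \<beta> where a: "a = (\<alpha>, \<beta>)" by fastforce
  have 1: "\<alpha> * cost \<pi> + \<beta> * val \<pi> \<le> b" if "\<pi> \<in> ?\<Pi>" for \<pi>
    using ab(2) that by (auto simp: G_def a)
  have 2: "b \<le> \<alpha> * c + \<beta> * v" if "c \<le> r" "V < v" for c v
    using ab(3) that by (auto simp: T_def a)
  have "\<alpha> \<le> 0"
  proof (rule ccontr)
    assume *: "\<not> \<alpha> \<le> 0"
    \<comment> \<open>\<open>T\<close> is unbounded to the left, so a positive \<alpha> would push
      the right-hand side below \<open>b\<close>; \<open>min\<close> with \<open>r\<close> keeps the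
      test point in \<open>T\<close>.\<close>
    define B where "B = b - \<beta> * (V + 1)"
    have "B \<le> \<alpha> * min r ((B - 1) / \<alpha>)" using 2[of "min r ((B - 1) / \<alpha>)" "V + 1"] by (simp add: B_def)
    also have "\<dots> \<le> \<alpha> * ((B - 1) / \<alpha>)" using * by (intro mult_left_mono) auto
    finally show False using * by simp
  qed
  have "\<beta> \<ge> 0"
  proof (rule ccontr)
    assume *: "\<not> \<beta> \<ge> 0"
    \<comment> \<open>The same argument upwards: \<open>T\<close> is unbounded in its second
      coordinate, and \<open>max\<close> with \<open>V + 1\<close> keeps the test point in
      \<open>T\<close>.\<close>
    define B where "B = b - \<alpha> * r"
    have "B \<le> \<beta> * max (V + 1) ((B - 1) / \<beta>)" 
      using 2[OF order_refl, of "max (V + 1) ((B - 1) / \<beta>)"] by (simp add: B_def less_max_iff_disj)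
    also have "\<dots> \<le> \<beta> * ((B - 1) / \<beta>)" using * by (intro mult_left_mono_neg) auto
    finally show False using * by simp
  qed
  moreover have "\<beta> \<noteq> 0"
  proof
    \<comment> \<open>Slater point: \<open>\<pi>0\<close> leaves every sample in place at cost 0,
      below \<open>r\<close>, so a vertical hyperplane would give
      \<open>0 \<le> b \<le> \<alpha> * r < 0\<close>.\<close>
    assume \<beta>: "\<beta> = 0"
    then have "\<alpha> < 0" using \<open>\<alpha> \<le> 0\<close> ab(1) a by (simp add: zero_prod_def)
    then have "\<alpha> * r < 0" using r by (simp add: mult_neg_pos)
    with 1[OF \<pi>0(1)] 2[of r "V + 1"] \<beta> \<pi>0(2) show False by simp
  qed
  ultimately have \<beta>: "\<beta> > 0" by simp
  define lam where "lam = - \<alpha> / \<beta>"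
  have lam: "lam \<ge> 0" using \<open>\<alpha> \<le> 0\<close> \<beta> by (simp add: lam_def field_simps)
  have \<alpha>: "\<alpha> = - (\<beta> * lam)" using \<beta> by (simp add: lam_def)
  have dual: "val \<pi> - lam * cost \<pi> \<le> V - lam * r" if "\<pi> \<in> ?\<Pi>" for \<pi>
  proof -
    \<comment> \<open>Membership in \<open>T\<close> requires \<open>V < v\<close> strictly, so the
      bound at \<open>V\<close> is reached in the limit, with \<open>c = r\<close>
      throughout.\<close>
    have "val \<pi> - lam * cost \<pi> + lam * r \<le> V"
    proof (rule dense_ge)
      fix v assume "V < v"
      then have "\<beta> * (val \<pi> - lam * cost \<pi>) \<le> \<beta> * (v - lam * r)"
        using 1[OF that] 2[of r v] by (simp add: \<alpha> algebra_simps)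
      then show "val \<pi> - lam * cost \<pi> + lam * r \<le> v" using \<beta> by simp
    qed
    then show ?thesis by simp
  qed
  define F where "F j z = f z - lam * nrm (z - \<xi>h j)" for j z
  \<comment> \<open>For a deterministic plan the dual inequality, scaled by \<open>N\<close>, bounds
    a sum whose summands depend on independently chosen points.\<close>
  have F: "(\<Sum>j=1..N. F j (z j)) \<le> real N * (V - lam * r)" if z: "z \<in> {1..N} \<rightarrow> \<Xi>" for z
  proof -
    have zN: "\<forall>j\<in>{1..N}. z j \<in> \<Xi>" using z by (auto simp: Pi_iff)
    let ?S = "\<Sum>j=1..N. f (z j)" and ?C = "\<Sum>j=1..N. nrm (z j - \<xi>h j)"
    have "(\<Sum>j=1..N. F j (z j)) = ?S - lam * ?C"
      by (simp only: F_def sum_subtractf sum_distrib_left)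
    also have "\<dots> = real N * (1 / real N * ?S - lam * (1 / real N * ?C))"
      using N by (simp add: right_diff_distrib)
    also have "\<dots> \<le> real N * (V - lam * r)"
      using dual[OF sel(1)[OF zN]] unfolding sel(2,3)[OF zN] by (intro mult_left_mono) simp_all
    finally show ?thesis .
  qed
  \<comment> \<open>The least values admissible for \<open>lam\<close>; \<open>sum_cSUP_le\<close>
    shows that they are genuine suprema and bounds their sum.\<close>
  define s where "s j = (SUP z\<in>\<Xi>. F j z)" for j
  have "\<Xi> \<noteq> {}" using N \<xi>h by force
  note sup = sum_cSUP_le[where F = F, OF finite_atLeastAtMost this F]
  show thesis
  proof (rule that[OF lam])
    have "1 / real N * (\<Sum>j=1..N. s j) \<le> 1 / real N * (real N * (V - lam * r))"
      unfolding s_def by (intro mult_left_mono sup(2)) auto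
    also have "\<dots> = V - lam * r" using N by simp
    finally show "lam * r + 1 / real N * (\<Sum>j=1..N. s j) \<le> V" by simp
    fix j z assume "j \<in> {1..N}" "z \<in> \<Xi>"
    then have "F j z \<le> s j" unfolding s_def by (intro cSUP_upper bspec[OF sup(1)])
    then show "f z \<le> s j + lam * nrm (z - \<xi>h j)" by (simp add: F_def)
  qed
qed

section \<open>The reformulation\<close>

text \<open>Subtracting a minimum of infima adds a supremum, so a bound on the integrand splits into
  one inequality per affine piece, core set and core point. The indices \<open>k\<close> and
  \<open>i\<close> are attained; the infimum over \<open>Y i\<close> is treated as a greatest lower
  bound.\<close>

lemma Max_minus_Min_Inf_le_iff:
  fixes u :: "nat \<Rightarrow> real" and g :: "nat \<Rightarrow> 'a \<Rightarrow> real"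
  assumes "K \<ge> 1" "m \<ge> 1" and Y: "\<And>i. i \<in> {1..m} \<Longrightarrow> Y i \<noteq> {}"
    and \<theta>: "\<And>i. i \<in> {1..m} \<Longrightarrow> \<theta> i > 0" and g: "\<And>i z. i \<in> {1..m} \<Longrightarrow> 0 \<le> g i z"
  shows "Max (u ` {1..K}) - Min ((\<lambda>i. \<theta> i * (INF z\<in>Y i. g i z)) ` {1..m}) \<le> c
    \<longleftrightarrow> (\<forall>k\<in>{1..K}. \<forall>i\<in>{1..m}. \<forall>z\<in>Y i. u k - \<theta> i * g i z \<le> c)" (is "?M - Min (?P ` _) \<le> c \<longleftrightarrow> ?R")
proof
  assume le: "?M - Min (?P ` {1..m}) \<le> c"
  show ?R
  proof (intro ballI)
    fix k i z assume k: "k \<in> {1..K}" and i: "i \<in> {1..m}" and z: "z \<in> Y i"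
    have "u k \<le> ?M" using k by (intro Max_ge) auto
    moreover have "Min (?P ` {1..m}) \<le> ?P i" using i by (intro Min_le) auto
    moreover have "?P i \<le> \<theta> i * g i z"
      using i \<theta>[OF i] g[OF i] z by (intro mult_left_mono cINF_lower bdd_belowI2[where m = 0]) auto
    ultimately show "u k - \<theta> i * g i z \<le> c" using le by linarith
  qed
next
  assume R: ?R
  have "?M \<in> u ` {1..K}" using assms by (intro Max_in) auto
  then obtain k where k: "k \<in> {1..K}" "?M = u k" by blast
  have "Min (?P ` {1..m}) \<in> ?P ` {1..m}" using assms by (intro Min_in) auto
  then obtain i where i: "i \<in> {1..m}" "Min (?P ` {1..m}) = ?P i" by blast
  have "(u k - c) / \<theta> i \<le> (INF z\<in>Y i. g i z)"
  proof (rule cINF_greatest[OF Y[OF i(1)]])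
    fix z assume "z \<in> Y i"
    then have "u k - \<theta> i * g i z \<le> c" using R k(1) i(1) by blast
    then show "(u k - c) / \<theta> i \<le> g i z" using \<theta>[OF i(1)] by (simp add: pos_divide_le_eq mult.commute)
  qed
  then have "u k - c \<le> ?P i" using \<theta>[OF i(1)] by (simp add: pos_divide_le_eq mult.commute)
  then show "?M - Min (?P ` {1..m}) \<le> c" using k i by simp
qed

text \<open>Attainment in \<open>strong\<close> is what carries minimisers, and not only optimal
  values, from \<open>wc\<close> to pairs \<open>(x, p)\<close>.\<close>

lemma exact_dual_reformulation:
  fixes wc :: "'x \<Rightarrow> ereal" and ob :: "'d \<Rightarrow> real"
  assumes weak: "\<And>x p. feas x p \<Longrightarrow> x \<in> X \<and> wc x \<le> ereal (ob p)"
    and strong: "\<And>x. x \<in> X \<Longrightarrow> \<exists>p. feas x p \<and> ereal (ob p) \<le> wc x"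
  shows "(\<forall>x\<in>X. wc x = (INF p\<in>{p. feas x p}. ereal (ob p)))
    \<and> (INF x\<in>X. wc x) = (INF (x, p)\<in>{(x, p). feas x p}. ereal (ob p))
    \<and> {x. is_arg_min wc (\<lambda>x. x \<in> X) x}
        = {x. \<exists>p. is_arg_min (\<lambda>(x, p). ob p) (\<lambda>(x, p). feas x p) (x, p)}"
proof (intro conjI ballI)
  fix x assume "x \<in> X"
  then obtain p where "feas x p" "ereal (ob p) \<le> wc x" using strong by blast
  then show "wc x = (INF p\<in>{p. feas x p}. ereal (ob p))"
    using weak by (intro antisym INF_greatest INF_lower2[of p]) auto
next
  show "(INF x\<in>X. wc x) = (INF (x, p)\<in>{(x, p). feas x p}. ereal (ob p))"
  proof (intro antisym INF_greatest)
    fix q assume "q \<in> {(x, p). feas x p}"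
    then obtain x p where "q = (x, p)" "feas x p" by blast
    then show "(INF x\<in>X. wc x) \<le> (case q of (x, p) \<Rightarrow> ereal (ob p))"
      using weak[of x p] by (auto intro: INF_lower2[of x])
  next
    fix x assume "x \<in> X"
    then obtain p where "feas x p" "ereal (ob p) \<le> wc x" using strong by blast
    then show "(INF (x, p)\<in>{(x, p). feas x p}. ereal (ob p)) \<le> wc x"
      by (intro INF_lower2[of "(x, p)"]) auto
  qed
next
  show "{x. is_arg_min wc (\<lambda>x. x \<in> X) x}
      = {x. \<exists>p. is_arg_min (\<lambda>(x, p). ob p) (\<lambda>(x, p). feas x p) (x, p)}"
  proof (intro set_eqI iffI; clarify)
    fix x assume x: "is_arg_min wc (\<lambda>x. x \<in> X) x"
    then obtain p where p: "feas x p" "ereal (ob p) \<le> wc x"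
      using strong unfolding is_arg_min_def by blast
    have "ob p \<le> ob p'" if "feas x' p'" for x' p'
    proof -
      have "wc x \<le> wc x'" using x weak[OF that] unfolding is_arg_min_def by (meson not_le)
      then have "ereal (ob p) \<le> ereal (ob p')" using p(2) weak[OF that] by (meson order_trans)
      then show ?thesis by simp
    qed
    then show "\<exists>p. is_arg_min (\<lambda>(x, p). ob p) (\<lambda>(x, p). feas x p) (x, p)"
      using p(1) by (intro exI[of _ p]) (auto simp: is_arg_min_def not_less)
  next
    fix x p assume p: "is_arg_min (\<lambda>(x, p). ob p) (\<lambda>(x, p). feas x p) (x, p)"
    then have feas: "feas x p" and min: "\<And>x' p'. feas x' p' \<Longrightarrow> ob p \<le> ob p'"
      by (auto simp: is_arg_min_def not_less)
    have "wc x \<le> wc x'" if x': "x' \<in> X" for x'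
    proof -
      obtain p' where p': "feas x' p'" "ereal (ob p') \<le> wc x'" using strong[OF x'] by blast
      have "wc x \<le> ereal (ob p)" using weak[OF feas] by blast
      also have "\<dots> \<le> ereal (ob p')" using min[OF p'(1)] by simp
      finally show ?thesis using p'(2) by order
    qed
    then show "is_arg_min wc (\<lambda>x. x \<in> X) x"
      using weak[OF feas] by (auto simp: is_arg_min_def not_less)
  qed
qed

theorem theorem2p2:
  fixes X :: "(real ^ 'n) set"
    and nrm :: "real ^ 'p \<Rightarrow> real"
    and N m K :: nat
    and \<xi>h :: "nat \<Rightarrow> real ^ 'p"
    and \<xi> :: "nat \<Rightarrow> real ^ 'p"
    and A :: "real ^ 'l ^ 'p"
    and Ai :: "nat \<Rightarrow> real ^ 'l ^ 'p"
    and Z1 :: "nat \<Rightarrow> (real ^ 'l) set"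
    and Z2 :: "(real ^ 'l) set"
    and Y :: "nat \<Rightarrow> (real ^ 'p) set"
    and \<Xi> :: "(real ^ 'p) set"
    and \<theta> :: "nat \<Rightarrow> real"
    and \<phi> :: "nat \<Rightarrow> real ^ 'p \<Rightarrow> real ^ 'p \<Rightarrow> real"
    and a :: "nat \<Rightarrow> real ^ 'n \<Rightarrow> real ^ 'p"
    and b :: "nat \<Rightarrow> real ^ 'n \<Rightarrow> real"
    and h :: "real ^ 'n \<Rightarrow> real ^ 'p \<Rightarrow> real"
    and worst_case :: "real ^ 'n \<Rightarrow> ereal"
    and feasible :: "real ^ 'n \<Rightarrow> real \<Rightarrow> (nat \<Rightarrow> real)
          \<Rightarrow> (nat \<Rightarrow> nat \<Rightarrow> nat \<Rightarrow> real ^ 'p) \<Rightarrow> (nat \<Rightarrow> nat \<Rightarrow> nat \<Rightarrow> real ^ 'p) \<Rightarrow> bool"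
    and obj :: "real \<Rightarrow> (nat \<Rightarrow> real) \<Rightarrow> real"
    and r :: real
  assumes "closed X" and "convex X"
    and "is_norm nrm"
    and "N \<ge> 1" and "m \<ge> 1" and "K \<ge> 1"
    and "r > 0"
    and "\<forall>k\<in>{1..K}. linear (a k) \<and> linear (b k)"
    and "\<forall>i\<in>{1..m}. Z1 i \<noteq> {} \<and> convex (Z1 i) \<and> compact (Z1 i) \<and> 0 \<in> rel_interior (Z1 i)"
    and "convex Z2"
    and "\<forall>i\<in>{1..m}. Y i = {\<xi> i + Ai i *v \<zeta> | \<zeta>. \<zeta> \<in> Z1 i}"
    and "\<Xi> = {\<xi> 0 + A *v \<zeta> | \<zeta>. \<zeta> \<in> Z2}"
    and "\<forall>i\<in>{1..m}. Y i \<subseteq> \<Xi>"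
    and "\<forall>j\<in>{1..N}. \<xi>h j \<in> \<Xi>"
    and "\<forall>i\<in>{1..m}. \<theta> i > 0"
    and "\<forall>i\<in>{1..m}. closed (epigraph UNIV (\<lambda>(z, z'). \<phi> i z z'))
            \<and> convex_on UNIV (\<lambda>(z, z'). \<phi> i z z')
            \<and> (\<forall>z z'. \<phi> i z z' \<ge> 0) \<and> (\<forall>z. \<phi> i z z = 0)"
  defines "h \<equiv> \<lambda>x z. Max ((\<lambda>k. a k x \<bullet> z + b k x) ` {1..K})"
    and "worst_case \<equiv> \<lambda>x. SUP P\<in>wasserstein_ball nrm \<Xi> N \<xi>h r.
           ext_expectation P
             (\<lambda>z. h x z - Min ((\<lambda>i. \<theta> i * (INF z'\<in>Y i. \<phi> i z z')) ` {1..m}))"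
    and "feasible \<equiv> \<lambda>x lam s v w.
           x \<in> X \<and> lam \<ge> 0 \<and>
           (\<forall>j\<in>{1..N}. \<forall>i\<in>{1..m}. \<forall>k\<in>{1..K}.
              ereal (\<xi> i \<bullet> v i j k) + support_function (Z1 i) (transpose (Ai i) *v v i j k)
              + ereal (\<xi> 0 \<bullet> w i j k) + support_function Z2 (transpose A *v w i j k)
              + ereal (- (\<xi>h j \<bullet> (v i j k + w i j k - a k x)) + b k x - s j)
              + ereal (\<theta> i) * joint_conjugate (\<phi> i) ((1 / \<theta> i) *\<^sub>R v i j k)
                                                     (- ((1 / \<theta> i) *\<^sub>R v i j k)) \<le> 0
              \<and> dual_norm nrm (v i j k + w i j k - a k x) \<le> lam)"
    and "obj \<equiv> \<lambda>lam s. lam * r + 1 / real N * (\<Sum>j=1..N. s j)"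
  shows "(\<forall>x\<in>X. worst_case x
            = (INF (lam, s, v, w)\<in>{(lam, s, v, w). feasible x lam s v w}. ereal (obj lam s)))
    \<and> (INF x\<in>X. worst_case x)
        = (INF (x, lam, s, v, w)\<in>{(x, lam, s, v, w). feasible x lam s v w}. ereal (obj lam s))
    \<and> {x. is_arg_min worst_case (\<lambda>x. x \<in> X) x}
        = {x. \<exists>lam s v w. is_arg_min (\<lambda>(x, lam, s, v, w). obj lam s)
                 (\<lambda>(x, lam, s, v, w). feasible x lam s v w) (x, lam, s, v, w)}"
proof -

  \<comment> \<open>Regularity of the data and splitting of the integrand\<close>
  note nrm = assms(3) and N = assms(4) and m = assms(5) and K = assms(6) and r = assms(7)
    and Z1 = assms(9) and Z2 = assms(10) and Y = assms(11) and \<Xi> = assms(12) and \<xi>h = assms(14)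
    and \<theta> = assms(15) and \<phi> = assms(16)
  define f where "f x z = h x z - Min ((\<lambda>i. \<theta> i * (INF z'\<in>Y i. \<phi> i z z')) ` {1..m})" for x z
  have Z2_ne: "Z2 \<noteq> {}" using \<xi>h N \<Xi> by force
  have Y_ne: "Y i \<noteq> {}" "convex (Y i)" if "i \<in> {1..m}" for i
  proof -
    have Y_eq: "Y i = (+) (\<xi> i) ` ((*v) (Ai i) ` Z1 i)" using Y that by auto
    show "Y i \<noteq> {}" unfolding Y_eq using Z1 that by simp
    show "convex (Y i)"
      unfolding Y_eq using Z1 that
      by (intro convex_translation convex_linear_image matrix_vector_mul_linear) blast
  qed
  have f_meas: "f x \<in> borel_measurable borel" for x
  proof -
    have "(\<lambda>z. \<theta> i * (INF z'\<in>Y i. \<phi> i z z')) \<in> borel_measurable borel" if "i \<in> {1..m}" for i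
      using \<phi> that Y_ne[OF that]
      by (intro borel_measurable_continuous_onI continuous_on_mult_left continuous_on_partial_Inf) auto
    then show ?thesis
      unfolding f_def h_def
      by (intro borel_measurable_diff borel_measurable_Max borel_measurable_Min) auto
  qed
  have f_le_iff: "f x z \<le> c \<longleftrightarrow> (\<forall>k\<in>{1..K}. \<forall>i\<in>{1..m}. \<forall>z'\<in>Y i.
      a k x \<bullet> z + b k x - \<theta> i * \<phi> i z z' \<le> c)" for x z c
    unfolding f_def h_def by (rule Max_minus_Min_Inf_le_iff) (use K m Y_ne \<theta> \<phi> in auto)
  have wc: "worst_case x = (SUP P\<in>wasserstein_ball nrm \<Xi> N \<xi>h r. ext_expectation P (f x))" for x
    unfolding worst_case_def f_def ..
  have upper: "worst_case x \<le> ereal (obj lam s)"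
    if "lam \<ge> 0" "\<And>j z. j \<in> {1..N} \<Longrightarrow> z \<in> \<Xi> \<Longrightarrow> f x z \<le> s j + lam * nrm (z - \<xi>h j)" for x lam s
    unfolding wc obj_def using r that
    by (intro SUP_least ext_expectation_le_dual_objective[OF nrm N \<xi>h f_meas]) auto
  have weak: "worst_case x \<le> ereal (obj lam s)" if feas: "feasible x lam s v w" for x lam s v w
  proof (rule upper)
    show "lam \<ge> 0" using feas by (simp add: feasible_def)
    fix j z assume j: "j \<in> {1..N}" and z: "z \<in> \<Xi>"
    show "f x z \<le> s j + lam * nrm (z - \<xi>h j)"
      unfolding f_le_iff
    proof (intro ballI)
      fix k i z' assume k: "k \<in> {1..K}" and i: "i \<in> {1..m}" and z': "z' \<in> Y i"
      obtain \<zeta> where \<zeta>: "\<zeta> \<in> Z1 i" "z' = \<xi> i + Ai i *v \<zeta>" using z' i Y by blast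
      obtain \<eta> where \<eta>: "\<eta> \<in> Z2" "z = \<xi> 0 + A *v \<eta>" using z \<Xi> by blast
      have "\<theta> i > 0" using \<theta> i by blast
      then show "a k x \<bullet> z + b k x - \<theta> i * \<phi> i z z' \<le> s j + lam * nrm (z - \<xi>h j)"
        using feas i j k unfolding feasible_def
        by (intro le_of_dual_constraint[OF nrm _ _ _ \<zeta>(1) \<eta>(1) \<eta>(2) \<zeta>(2)]) blast+
    qed
  qed
  have strong: "\<exists>lam s v w. feasible x lam s v w \<and> ereal (obj lam s) \<le> worst_case x" if x: "x \<in> X" for x
  proof -
    \<comment> \<open>A common Lipschitz constant, with respect to \<open>nrm\<close>, of all affine
      pieces. With \<open>s j = h x (\<xi>h j)\<close> it gives a crude dual bound, so the worst
      case is not \<infinity>.\<close>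
    define L where "L = (\<Sum>k=1..K. dual_norm nrm (a k x))"
    have "worst_case x \<le> ereal (obj L (\<lambda>j. h x (\<xi>h j)))"
    proof (rule upper)
      show "L \<ge> 0" unfolding L_def by (intro sum_nonneg dual_norm_nonneg nrm)
      fix j z
      show "f x z \<le> h x (\<xi>h j) + L * nrm (z - \<xi>h j)"
        unfolding f_le_iff
      proof (intro ballI)
        fix k i z' assume k: "k \<in> {1..K}" and i: "i \<in> {1..m}"
        have "a k x \<bullet> (z - \<xi>h j) \<le> dual_norm nrm (a k x) * nrm (z - \<xi>h j)"
          by (rule inner_le_dual_norm[OF nrm])
        also have "\<dots> \<le> L * nrm (z - \<xi>h j)"
          unfolding L_def using k
          by (intro mult_right_mono member_le_sum is_norm_nonneg dual_norm_nonneg nrm) auto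
        finally have "a k x \<bullet> z \<le> a k x \<bullet> \<xi>h j + L * nrm (z - \<xi>h j)" by (simp add: inner_diff_right)
        moreover have "a k x \<bullet> \<xi>h j + b k x \<le> h x (\<xi>h j)"
          unfolding h_def using k by (intro Max_ge) auto
        moreover have "0 \<le> \<theta> i * \<phi> i z z'"
          using \<theta> \<phi> i by (intro mult_nonneg_nonneg) (auto intro: less_imp_le)
        ultimately show "a k x \<bullet> z + b k x - \<theta> i * \<phi> i z z' \<le> h x (\<xi>h j) + L * nrm (z - \<xi>h j)"
          by linarith
      qed
    qed
    moreover have "worst_case x > - \<infinity>"
    proof -
      \<comment> \<open>The plan leaving all samples in place yields a member of the ball with a
        real expectation.\<close>
      define \<pi> where "\<pi> = map_pmf (\<lambda>j. (\<xi>h j, \<xi>h j)) (pmf_of_set {1..N})"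
      have "\<pi> \<in> finite_plans \<Xi> N \<xi>h"
        unfolding \<pi>_def using \<xi>h by (intro finite_plans_selection N) blast
      moreover have "measure_pmf.expectation \<pi> (\<lambda>p. nrm (fst p - snd p)) \<le> r"
        unfolding \<pi>_def expectation_map_pmf_of_set[OF N] using r by (simp add: is_norm_zero[OF nrm])
      ultimately obtain P where "P \<in> wasserstein_ball nrm \<Xi> N \<xi>h r"
          "ext_expectation P (f x) = ereal (measure_pmf.expectation \<pi> (\<lambda>p. f x (fst p)))"
        using finite_plan_in_wasserstein_ball[OF nrm N \<xi>h f_meas] by blast
      then show ?thesis unfolding wc by (intro less_SUP_iff[THEN iffD2] bexI[of _ P]) auto
    qed
    \<comment> \<open>Both bounds together make the worst case real, as
      \<open>ex_dual_multiplier\<close> requires of \<open>V\<close>.\<close>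
    ultimately obtain V where V: "worst_case x = ereal V" by (cases "worst_case x") auto
    have "ext_expectation P (f x) \<le> ereal V" if "P \<in> wasserstein_ball nrm \<Xi> N \<xi>h r" for P
      using that unfolding V[symmetric] wc by (rule SUP_upper)
    then obtain lam s where lam: "lam \<ge> 0" "lam * r + 1 / real N * (\<Sum>j=1..N. s j) \<le> V"
        and le: "\<And>j z. j \<in> {1..N} \<Longrightarrow> z \<in> \<Xi> \<Longrightarrow> f x z \<le> s j + lam * nrm (z - \<xi>h j)"
      using ex_dual_multiplier[OF nrm N \<xi>h f_meas r, of x V] by blast
    let ?C = "\<lambda>j i k v w.
        ereal (\<xi> i \<bullet> v) + support_function (Z1 i) (transpose (Ai i) *v v)
        + ereal (\<xi> 0 \<bullet> w) + support_function Z2 (transpose A *v w)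
        + ereal (- (\<xi>h j \<bullet> (v + w - a k x)) + b k x - s j)
        + ereal (\<theta> i) * joint_conjugate (\<phi> i) ((1 / \<theta> i) *\<^sub>R v) (- ((1 / \<theta> i) *\<^sub>R v)) \<le> 0
        \<and> dual_norm nrm (v + w - a k x) \<le> lam"
    \<comment> \<open>Guarding by an implication gives witnesses at all indices, so that choice
      produces total families \<open>v\<close> and \<open>w\<close>.\<close>
    have "\<forall>i j k. \<exists>v w. j \<in> {1..N} \<and> i \<in> {1..m} \<and> k \<in> {1..K} \<longrightarrow> ?C j i k v w"
    proof (intro allI)
      fix i j k
      show "\<exists>v w. j \<in> {1..N} \<and> i \<in> {1..m} \<and> k \<in> {1..K} \<longrightarrow> ?C j i k v w"
      proof (cases "j \<in> {1..N} \<and> i \<in> {1..m} \<and> k \<in> {1..K}")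
        case True
        then have jik: "j \<in> {1..N}" "i \<in> {1..m}" "k \<in> {1..K}" by auto
        have "\<exists>v w. ?C j i k v w"
        proof (rule ex_dual_constraint)
          fix \<zeta> \<eta> z z'
          assume *: "\<zeta> \<in> Z1 i" "\<eta> \<in> Z2" "z = \<xi> 0 + A *v \<eta>" "z' = \<xi> i + Ai i *v \<zeta>"
          then have "z \<in> \<Xi>" "z' \<in> Y i" using \<Xi> Y jik by auto
          then show "a k x \<bullet> z + b k x - \<theta> i * \<phi> i z z' \<le> s j + lam * nrm (z - \<xi>h j)"
            using le[OF jik(1) \<open>z \<in> \<Xi>\<close>] jik unfolding f_le_iff by blast
        qed (use nrm lam(1) Z2 Z2_ne Z1 \<theta> \<phi> jik in auto)
        then show ?thesis by blast
      qed auto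
    qed
    then obtain v w where
      "\<forall>i j k. j \<in> {1..N} \<and> i \<in> {1..m} \<and> k \<in> {1..K} \<longrightarrow> ?C j i k (v i j k) (w i j k)"
      unfolding choice_iff by blast
    then have "feasible x lam s v w" unfolding feasible_def using x lam(1) by blast
    moreover have "ereal (obj lam s) \<le> worst_case x" using lam(2) by (simp add: V obj_def)
    ultimately show ?thesis by blast
  qed
  \<comment> \<open>The remaining variables are packed into one tuple \<open>p\<close> to fit
    \<open>exact_dual_reformulation\<close>.\<close>
  have "(\<forall>x\<in>X. worst_case x = (INF p\<in>{p. case p of (lam, s, v, w) \<Rightarrow> feasible x lam s v w}.
          ereal (case p of (lam, s, v, w) \<Rightarrow> obj lam s)))
    \<and> (INF x\<in>X. worst_case x)
        = (INF (x, p)\<in>{(x, p). case p of (lam, s, v, w) \<Rightarrow> feasible x lam s v w}.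
            ereal (case p of (lam, s, v, w) \<Rightarrow> obj lam s))
    \<and> {x. is_arg_min worst_case (\<lambda>x. x \<in> X) x}
        = {x. \<exists>p. is_arg_min (\<lambda>(x, p). case p of (lam, s, v, w) \<Rightarrow> obj lam s)
                 (\<lambda>(x, p). case p of (lam, s, v, w) \<Rightarrow> feasible x lam s v w) (x, p)}"
  proof (rule exact_dual_reformulation)
    fix x p assume "case p of (lam, s, v, w) \<Rightarrow> feasible x lam s v w"
    then show "x \<in> X \<and> worst_case x \<le> ereal (case p of (lam, s, v, w) \<Rightarrow> obj lam s)"
      using weak by (cases p) (auto simp: feasible_def)
  next
    fix x assume "x \<in> X"
    then show "\<exists>p. (case p of (lam, s, v, w) \<Rightarrow> feasible x lam s v w)
        \<and> ereal (case p of (lam, s, v, w) \<Rightarrow> obj lam s) \<le> worst_case x"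
      using strong by simp
  qed
  then show ?thesis unfolding case_prod_unfold split_paired_Ex .
qed

end
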